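(* Let $\mathbf{k}$ be a field of characteristic $0$ and $B$ a normal affine $\mathbf{k}$-domain graded over $\mathbf{k}$ by a finitely generated abelian group $G$. If $B$ is saturated in codimension $1$ then $\mathcal{X}(B) = \emptyset$ or $\mathcal{X}(B) = \mathbb{T}(B)$.
   Context: Rings are commutative, associative and unital; "domain" means integral domain; a domain is normal if it is integrally closed in its field of fractions. An affine $\mathbf{k}$-domain is a domain that is a finitely generated $\mathbf{k}$-algebra. For an abelian group $G$ (written additively), a $G$-graded ring is a ring $B=\bigoplus_{i\in G}B_i$ with $B_iB_j\subseteq B_{i+j}$. A $\mathbf{k}$-algebra $B$ is graded over $\mathbf{k}$ by $G$ if it is $G$-graded and $\mathbf{k}\subseteq B_0$. For a $G$-graded domain $B$, $\mathbb{G}(B)$ is the subgroup of $G$ generated by $\{i\in G : B_i\neq 0\}$. For a subgroup $H$ of $G$, $B^{(H)}=\bigoplus_{i\in H}B_i$, an $H$-graded ring. $\mathbb{T}(B)$ is the set of subgroups $H$ of $G$ such that $\mathbb{G}(B)/(H\cap\mathbb{G}(B))$ is a torsion group. Let $\mathrm{Spec}^1(B)$ be the set of all prime ideals of $B$ of height $1$ (not necessarily homogeneous). For $\mathfrak{p}\in\mathrm{Spec}(B)$, $\mathbb{M}(B,\mathfrak{p})=\{i\in G: B_i\nsubseteq\mathfrak{p}\}$, a submonoid of $\mathbb{G}(B)$, and $\overline{\mathbb{M}}(B,\mathfrak{p})$ is the subgroup it generates. Define $\bar{\mathbb{G}}(B)=\bigcap_{\mathfrak{p}\in\mathrm{Spec}^1(B)}\overline{\mathbb{M}}(B,\mathfrak{p})$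 if $\mathrm{Spec}^1(B)\neq\emptyset$, and $\bar{\mathbb{G}}(B)=\mathbb{G}(B)$ if $\mathrm{Spec}^1(B)=\emptyset$. $B$ is saturated in codimension $1$ if $\bar{\mathbb{G}}(B)=\mathbb{G}(B)$. A derivation $D:B\to B$ is locally nilpotent if for each $b\in B$ there is $n>0$ with $D^n(b)=0$; it is homogeneous if there is $d$ in the grading group with $D(B_i)\subseteq B_{i+d}$ for all $i$. $\mathrm{HLND}(B)$ is the set of homogeneous locally nilpotent derivations of a graded ring $B$. $\mathcal{X}(B)=\{H\in\mathbb{T}(B):\mathrm{HLND}(B^{(H)})\neq\{0\}\}$. *)

theory Defs
  imports
    "HOL-Library.Extended_Nat"
    "HOL-Computational_Algebra.Group_Closure"
    "HOL-Computational_Algebra.Polynomial_Factorial"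
begin

section \<open>Subgroups, subrings, prime ideals\<close>

definition is_subgroup :: "'g::ab_group_add set \<Rightarrow> bool" where
  "is_subgroup H \<longleftrightarrow> 0 \<in> H \<and> (\<forall>x\<in>H. \<forall>y\<in>H. x + y \<in> H) \<and> (\<forall>x\<in>H. - x \<in> H)"

definition fg_group :: "'g::ab_group_add itself \<Rightarrow> bool" where
  "fg_group _ \<longleftrightarrow> (\<exists>S::'g set. finite S \<and> group_closure S = UNIV)"

text \<open>For subgroups \<open>K \<subseteq> A\<close>: the quotient \<open>A/K\<close> is a torsion group, i.e. every coset \<open>a + K\<close>
  has a positive multiple \<open>n a + K\<close> that equals \<open>K\<close>. The sum is \<open>n a\<close>.\<close>

definition torsion_quotient :: "'g::ab_group_add set \<Rightarrow> 'g set \<Rightarrow> bool" where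
  "torsion_quotient A K \<longleftrightarrow> (\<forall>a\<in>A. \<exists>n>0. (\<Sum>_<(n::nat). a) \<in> K)"

definition is_subring :: "'b::comm_ring_1 set \<Rightarrow> bool" where
  "is_subring R \<longleftrightarrow> is_subgroup R \<and> 1 \<in> R \<and> (\<forall>x\<in>R. \<forall>y\<in>R. x * y \<in> R)"

definition is_ideal :: "'b::comm_ring_1 set \<Rightarrow> bool" where
  "is_ideal I \<longleftrightarrow> is_subgroup I \<and> (\<forall>x\<in>I. \<forall>r. r * x \<in> I)"

definition is_prime_ideal :: "'b::comm_ring_1 set \<Rightarrow> bool" where
  "is_prime_ideal P \<longleftrightarrow>
     is_ideal P \<and> P \<noteq> UNIV \<and> (\<forall>x y. x * y \<in> P \<longrightarrow> x \<in> P \<or> y \<in> P)"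

definition height :: "'b::comm_ring_1 set \<Rightarrow> enat" where
  "height P = Sup {enat n | n. \<exists>c :: nat \<Rightarrow> 'b set.
     (\<forall>i\<le>n. is_prime_ideal (c i)) \<and> (\<forall>i<n. c i \<subset> c (Suc i)) \<and> c n = P}"

definition Spec1 :: "'b::comm_ring_1 set set" where
  "Spec1 = {P. is_prime_ideal P \<and> height P = 1}"

section \<open>Normal affine domains\<close>

text \<open>The ring \<open>B\<close> is the whole type \<open>'b\<close>; its structure as a \<open>k\<close>-algebra is given by a ring
  homomorphism \<open>\<iota>\<close> from the field \<open>k\<close> (the type \<open>'k\<close>), automatically injective since \<open>1 \<noteq> 0\<close> in \<open>B\<close>.\<close>

definition algebra_map :: "('k::field \<Rightarrow> 'b::comm_ring_1) \<Rightarrow> bool" where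
  "algebra_map \<iota> \<longleftrightarrow> \<iota> 1 = 1 \<and> (\<forall>x y. \<iota> (x + y) = \<iota> x + \<iota> y) \<and> (\<forall>x y. \<iota> (x * y) = \<iota> x * \<iota> y)"

definition fg_algebra :: "('k::field \<Rightarrow> 'b::comm_ring_1) \<Rightarrow> bool" where
  "fg_algebra \<iota> \<longleftrightarrow> algebra_map \<iota> \<and>
     (\<exists>S. finite S \<and> \<Inter>{R. is_subring R \<and> range \<iota> \<subseteq> R \<and> S \<subseteq> R} = UNIV)"

definition integral_elt :: "'b::idom fract \<Rightarrow> bool" where
  "integral_elt x \<longleftrightarrow> (\<exists>p :: 'b poly. lead_coeff p = 1 \<and> poly (map_poly to_fract p) x = 0)"

definition normal_domain :: "'b::idom itself \<Rightarrow> bool" where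
  "normal_domain _ \<longleftrightarrow> (\<forall>x :: 'b fract. integral_elt x \<longrightarrow> x \<in> range to_fract)"

section \<open>Gradings\<close>

text \<open>From here on \<open>B\<close> denotes the family \<open>i \<mapsto> B i\<close> of homogeneous components; the ring itself is the type \<open>'b\<close>,
  and the grading group is the type \<open>'g\<close>. In \<open>is_grading\<close>, the unique existence expresses that the sum of
  the components is direct and is the whole ring.\<close>

definition is_grading :: "('g::ab_group_add \<Rightarrow> 'b::comm_ring_1 set) \<Rightarrow> bool" where
  "is_grading B \<longleftrightarrow>
     (\<forall>i. is_subgroup (B i)) \<and>
     (\<forall>x. \<exists>!f. (\<forall>i. f i \<in> B i) \<and> finite {i. f i \<noteq> 0} \<and> x = (\<Sum>i | f i \<noteq> 0. f i)) \<and>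
     (\<forall>i j. \<forall>x \<in> B i. \<forall>y \<in> B j. x * y \<in> B (i + j))"

definition graded_over :: "('k::field \<Rightarrow> 'b::comm_ring_1) \<Rightarrow> ('g::ab_group_add \<Rightarrow> 'b set) \<Rightarrow> bool" where
  "graded_over \<iota> B \<longleftrightarrow> is_grading B \<and> range \<iota> \<subseteq> B 0"

text \<open>\<open>\<GG>(B)\<close>, \<open>B\<^sup>(\<^sup>H\<^sup>)\<close> and \<open>\<TT>(B)\<close>.\<close>

definition grp :: "('g::ab_group_add \<Rightarrow> 'b::comm_ring_1 set) \<Rightarrow> 'g set" where
  "grp B = group_closure {i. B i \<noteq> {0}}"

definition subring_of_degrees :: "('g::ab_group_add \<Rightarrow> 'b::comm_ring_1 set) \<Rightarrow> 'g set \<Rightarrow> 'b set" where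
  "subring_of_degrees B H = {\<Sum>i\<in>I. f i | I f. finite I \<and> I \<subseteq> H \<and> (\<forall>i\<in>I. f i \<in> B i)}"

definition TT :: "('g::ab_group_add \<Rightarrow> 'b::comm_ring_1 set) \<Rightarrow> 'g set set" where
  "TT B = {H. is_subgroup H \<and> torsion_quotient (grp B) (H \<inter> grp B)}"

section \<open>Saturation in codimension 1\<close>

definition MM :: "('g::ab_group_add \<Rightarrow> 'b::comm_ring_1 set) \<Rightarrow> 'b set \<Rightarrow> 'g set" where
  "MM B P = {i. \<not> B i \<subseteq> P}"

definition MM_bar :: "('g::ab_group_add \<Rightarrow> 'b::comm_ring_1 set) \<Rightarrow> 'b set \<Rightarrow> 'g set" where
  "MM_bar B P = group_closure (MM B P)"

definition grp_bar :: "('g::ab_group_add \<Rightarrow> 'b::comm_ring_1 set) \<Rightarrow> 'g set" where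
  "grp_bar B = (if (Spec1 :: 'b set set) = {} then grp B else (\<Inter>P\<in>Spec1. MM_bar B P))"

definition saturated_codim1 :: "('g::ab_group_add \<Rightarrow> 'b::comm_ring_1 set) \<Rightarrow> bool" where
  "saturated_codim1 B \<longleftrightarrow> grp_bar B = grp B"

section \<open>Homogeneous locally nilpotent derivations\<close>

text \<open>A derivation \<open>A \<rightarrow> A\<close> of a subring \<open>A\<close> is represented by its extension by zero to the whole
  type, so that equal derivations are equal functions.\<close>

definition is_derivation :: "'b::comm_ring_1 set \<Rightarrow> ('b \<Rightarrow> 'b) \<Rightarrow> bool" where
  "is_derivation A D \<longleftrightarrow>
     D ` A \<subseteq> A \<and> (\<forall>x. x \<notin> A \<longrightarrow> D x = 0) \<and>
     (\<forall>x\<in>A. \<forall>y\<in>A. D (x + y) = D x + D y) \<and>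
     (\<forall>x\<in>A. \<forall>y\<in>A. D (x * y) = D x * y + x * D y)"

definition locally_nilpotent :: "'b::comm_ring_1 set \<Rightarrow> ('b \<Rightarrow> 'b) \<Rightarrow> bool" where
  "locally_nilpotent A D \<longleftrightarrow> (\<forall>b\<in>A. \<exists>n>0. (D ^^ n) b = 0)"

text \<open>Homogeneity for the \<open>H\<close>-graded ring \<open>B\<^sup>(\<^sup>H\<^sup>)\<close>: the degree \<open>d\<close> lies in the grading group \<open>H\<close>.\<close>

definition homogeneous :: "('g::ab_group_add \<Rightarrow> 'b::comm_ring_1 set) \<Rightarrow> 'g set \<Rightarrow> ('b \<Rightarrow> 'b) \<Rightarrow> bool" where
  "homogeneous B H D \<longleftrightarrow> (\<exists>d\<in>H. \<forall>i\<in>H. D ` B i \<subseteq> B (i + d))"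

text \<open>This is \<open>HLND(B\<^sup>(\<^sup>H\<^sup>))\<close>.\<close>

definition HLND :: "('g::ab_group_add \<Rightarrow> 'b::comm_ring_1 set) \<Rightarrow> 'g set \<Rightarrow> ('b \<Rightarrow> 'b) set" where
  "HLND B H = {D. is_derivation (subring_of_degrees B H) D \<and>
     locally_nilpotent (subring_of_degrees B H) D \<and> homogeneous B H D}"

definition XX :: "('g::ab_group_add \<Rightarrow> 'b::comm_ring_1 set) \<Rightarrow> 'g set set" where
  "XX B = {H \<in> TT B. HLND B H \<noteq> {\<lambda>_. 0}}"

end

theory Submission
  imports Defs
begin

text \<open>Let \<open>D\<close> be a nonzero homogeneous locally nilpotent derivation of \<open>B\<^sup>(\<^sup>H\<^sup>)\<close>. Every homogeneous \<open>x\<close> has a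
  power in \<open>B\<^sup>(\<^sup>H\<^sup>)\<close>, so \<open>D\<close> extends uniquely to the fraction field. By saturation, for a height one prime \<open>P\<close>
  there is a homogeneous \<open>u \<notin> P\<close> with \<open>x u\<close> in \<open>B\<^sup>(\<^sup>H\<^sup>)\<close>; this shows that \<open>D x\<close> lies in the localization at
  \<open>P\<close>, hence in \<open>B\<close>, as a normal Noetherian domain is the intersection of its localizations at height one primes.
  Comparing degrees shows that the extension is again locally nilpotent.

  Now let \<open>D\<close> be such a derivation of \<open>B\<close>, with kernel \<open>K\<close>, homogeneous local slice \<open>s\<close> and \<open>t = D s\<close>. The
  contraction of the ideal generated by \<open>s\<close> in \<open>B\<^sub>t = K\<^sub>t[s]\<close> is a height one prime, and homogeneous elements
  outside it have degrees in the group generated by the degrees of \<open>K\<close>. So, by saturation, the degrees of \<open>K\<close>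
  generate \<open>\<GG>(B)\<close>, and for any \<open>H'\<close> in \<open>\<TT>(B)\<close> there is a homogeneous \<open>k \<noteq> 0\<close> in \<open>K\<close> such that \<open>k D\<close> has
  degree in \<open>H'\<close>. It restricts to a nonzero derivation of the subring of degrees in \<open>H'\<close>.\<close>

section \<open>The Hilbert basis theorem\<close>

text \<open>Relative to a subset \<open>R\<close> rather than a type, since the intermediate rings
  in the basis theorem are subrings of one fixed type.\<close>

definition sub_ideal :: "'b::comm_ring_1 set \<Rightarrow> 'b set \<Rightarrow> bool" where
  "sub_ideal R I \<longleftrightarrow> is_subgroup I \<and> I \<subseteq> R \<and> (\<forall>r\<in>R. \<forall>x\<in>I. r * x \<in> I)"

definition noetherian_subring :: "'b::comm_ring_1 set \<Rightarrow> bool" where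
  "noetherian_subring R \<longleftrightarrow> is_subring R \<and>
     (\<forall>I :: nat \<Rightarrow> 'b set. (\<forall>n. sub_ideal R (I n)) \<longrightarrow> incseq I \<longrightarrow> (\<exists>N. \<forall>n\<ge>N. I n = I N))"

lemma is_subgroup_diff: "is_subgroup H \<Longrightarrow> x \<in> H \<Longrightarrow> y \<in> H \<Longrightarrow> x - y \<in> H"
  unfolding is_subgroup_def by (metis uminus_add_conv_diff add.commute)

lemma is_subgroup_sum:
  assumes "is_subgroup H" "\<And>i. i \<in> I \<Longrightarrow> f i \<in> H"
  shows "sum f I \<in> H"
  using assms by (induction I rule: infinite_finite_induct) (auto simp: is_subgroup_def)

definition adjoin :: "'b::comm_ring_1 set \<Rightarrow> 'b \<Rightarrow> 'b set" where
  "adjoin R x = {poly p x | p. \<forall>i. coeff p i \<in> R}"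

text \<open>The element \<open>x\<close> need not be transcendental over \<open>R\<close>: the ideal collects the coefficients at \<open>n\<close>
  of all polynomials of degree at most \<open>n\<close> whose value at \<open>x\<close> lies in \<open>I\<close>.\<close>

definition lead_ideal :: "'b::comm_ring_1 set \<Rightarrow> 'b \<Rightarrow> nat \<Rightarrow> 'b set \<Rightarrow> 'b set" where
  "lead_ideal R x n I =
     {coeff p n | p. (\<forall>i. coeff p i \<in> R) \<and> (\<forall>i>n. coeff p i = 0) \<and> poly p x \<in> I}"

lemma is_subring_adjoin:
  assumes "is_subring R"
  shows "is_subring (adjoin R x)"
proof -
  have R: "is_subgroup R" "1 \<in> R" "\<And>x y. x \<in> R \<Longrightarrow> y \<in> R \<Longrightarrow> x * y \<in> R"
    using assms by (auto simp: is_subring_def)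
  have R': "0 \<in> R" "\<And>x y. x \<in> R \<Longrightarrow> y \<in> R \<Longrightarrow> x + y \<in> R" "\<And>x. x \<in> R \<Longrightarrow> - x \<in> R"
    using R(1) by (auto simp: is_subgroup_def)
  have "0 \<in> adjoin R x" unfolding adjoin_def using R' by (auto intro!: exI[of _ 0])
  moreover have "1 \<in> adjoin R x" unfolding adjoin_def using R R'
    by (auto intro!: exI[of _ 1] simp: coeff_1)
  moreover have "a + b \<in> adjoin R x" if ab: "a \<in> adjoin R x" "b \<in> adjoin R x" for a b
  proof -
    obtain p q where "a = poly p x" "b = poly q x" "\<forall>i. coeff p i \<in> R" "\<forall>i. coeff q i \<in> R"
      using ab by (auto simp: adjoin_def)
    then show ?thesis unfolding adjoin_def using R' by (auto intro!: exI[of _ "p + q"])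
  qed
  moreover have "- a \<in> adjoin R x" if ab: "a \<in> adjoin R x" for a
  proof -
    obtain p where "a = poly p x" "\<forall>i. coeff p i \<in> R"
      using ab by (auto simp: adjoin_def)
    then show ?thesis unfolding adjoin_def using R' by (auto intro!: exI[of _ "- p"])
  qed
  moreover have "a * b \<in> adjoin R x" if ab: "a \<in> adjoin R x" "b \<in> adjoin R x" for a b
  proof -
    obtain p q where "a = poly p x" "b = poly q x" "\<forall>i. coeff p i \<in> R" "\<forall>i. coeff q i \<in> R"
      using ab by (auto simp: adjoin_def)
    then show ?thesis unfolding adjoin_def using R
      by (auto intro!: exI[of _ "p * q"] is_subgroup_sum simp: coeff_mult)
  qed
  ultimately show ?thesis by (auto simp: is_subring_def is_subgroup_def)
qed

lemma adjoin_superset: "0 \<in> R \<Longrightarrow> R \<subseteq> adjoin R x"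
  unfolding adjoin_def by (auto intro!: exI[of _ "[:_:]"] simp: coeff_pCons split: nat.split)

lemma adjoin_self: "0 \<in> R \<Longrightarrow> 1 \<in> R \<Longrightarrow> x \<in> adjoin R x"
  unfolding adjoin_def by (auto intro!: exI[of _ "[:0,1:]"] simp: coeff_pCons split: nat.split)

lemma sub_ideal_lead_ideal:
  assumes R: "is_subring R" and I: "sub_ideal (adjoin R x) I"
  shows "sub_ideal R (lead_ideal R x n I)"
proof -
  have R': "0 \<in> R" "\<And>x y. x \<in> R \<Longrightarrow> y \<in> R \<Longrightarrow> x + y \<in> R" "\<And>x. x \<in> R \<Longrightarrow> - x \<in> R"
    "\<And>x y. x \<in> R \<Longrightarrow> y \<in> R \<Longrightarrow> x * y \<in> R"
    using R by (auto simp: is_subgroup_def is_subring_def)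
  have I': "0 \<in> I" "\<And>x y. x \<in> I \<Longrightarrow> y \<in> I \<Longrightarrow> x + y \<in> I" "\<And>x. x \<in> I \<Longrightarrow> - x \<in> I"
    "\<And>r y. r \<in> R \<Longrightarrow> y \<in> I \<Longrightarrow> r * y \<in> I"
    using I adjoin_superset[OF R'(1), of x] by (auto simp: is_subgroup_def sub_ideal_def)
  let ?L = "lead_ideal R x n I"
  have "0 \<in> ?L" using R' I' unfolding lead_ideal_def by (auto intro!: exI[of _ 0])
  moreover have "?L \<subseteq> R" by (auto simp: lead_ideal_def)
  moreover have "a + b \<in> ?L" if "a \<in> ?L" "b \<in> ?L" for a b
  proof -
    obtain p q where "a = coeff p n" "b = coeff q n" "\<forall>i. coeff p i \<in> R" "\<forall>i. coeff q i \<in> R"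
       "\<forall>i>n. coeff p i = 0" "\<forall>i>n. coeff q i = 0" "poly p x \<in> I" "poly q x \<in> I"
      using \<open>a \<in> ?L\<close> \<open>b \<in> ?L\<close> unfolding lead_ideal_def by blast
    then show ?thesis unfolding lead_ideal_def using R' I' by (auto intro!: exI[of _ "p + q"])
  qed
  moreover have "- a \<in> ?L" if "a \<in> ?L" for a
  proof -
    obtain p where "a = coeff p n" "\<forall>i. coeff p i \<in> R" "\<forall>i>n. coeff p i = 0" "poly p x \<in> I"
      using \<open>a \<in> ?L\<close> unfolding lead_ideal_def by blast
    then show ?thesis unfolding lead_ideal_def using R' I' by (auto intro!: exI[of _ "- p"])
  qed
  moreover have "r * a \<in> ?L" if "r \<in> R" "a \<in> ?L" for a r
  proof -
    obtain p where "a = coeff p n" "\<forall>i. coeff p i \<in> R" "\<forall>i>n. coeff p i = 0" "poly p x \<in> I"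
      using \<open>a \<in> ?L\<close> unfolding lead_ideal_def by blast
    then show ?thesis unfolding lead_ideal_def using R' I' \<open>r \<in> R\<close>
      by (auto intro!: exI[of _ "smult r p"])
  qed
  ultimately show ?thesis by (auto simp: sub_ideal_def is_subgroup_def)
qed

lemma lead_ideal_mono: "I \<subseteq> J \<Longrightarrow> lead_ideal R x n I \<subseteq> lead_ideal R x n J"
  unfolding lead_ideal_def by blast

text \<open>Multiply the polynomial by the variable: its coefficients shift by one, and its value at
  \<open>x\<close> stays in the ideal.\<close>

lemma lead_ideal_Suc:
  assumes R: "is_subring R" and I: "sub_ideal (adjoin R x) I"
  shows "lead_ideal R x n I \<subseteq> lead_ideal R x (Suc n) I"
proof
  fix a assume "a \<in> lead_ideal R x n I"
  then obtain p where p: "a = coeff p n" "\<forall>i. coeff p i \<in> R" "\<forall>i>n. coeff p i = 0" "poly p x \<in> I"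
    unfolding lead_ideal_def by blast
  have R': "0 \<in> R" "1 \<in> R" using R by (auto simp: is_subgroup_def is_subring_def)
  have "x * poly p x \<in> I" using I p(4) adjoin_self[OF R'] by (auto simp: sub_ideal_def)
  then show "a \<in> lead_ideal R x (Suc n) I"
    unfolding lead_ideal_def using p R'
    by (auto intro!: exI[of _ "pCons 0 p"] simp: coeff_pCons split: nat.split)
qed

text \<open>Induction on a degree bound: from a polynomial with value in \<open>J\<close> one
  subtracts a polynomial with value in \<open>I\<close> and the same coefficient at the top index,
  which lowers the bound.\<close>

lemma lead_ideal_determines:
  assumes R: "is_subring R" and I: "sub_ideal (adjoin R x) I" and J: "sub_ideal (adjoin R x) J"
    and IJ: "I \<subseteq> J" and L: "\<And>n. lead_ideal R x n J \<subseteq> lead_ideal R x n I"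
  shows "I = J"
proof -
  have "poly p x \<in> I" if "\<forall>i. coeff p i \<in> R" "\<forall>i\<ge>n. coeff p i = 0" "poly p x \<in> J" for n p
    using that
  proof (induction n arbitrary: p)
    case 0
    then have "p = 0" by (simp add: poly_eq_iff)
    then show ?case using I by (simp add: sub_ideal_def is_subgroup_def)
  next
    case (Suc n)
    have "coeff p n \<in> lead_ideal R x n J" unfolding lead_ideal_def using Suc.prems by force
    then have "coeff p n \<in> lead_ideal R x n I" using L by blast
    then obtain q where q: "coeff p n = coeff q n" "\<forall>i. coeff q i \<in> R" "\<forall>i>n. coeff q i = 0"
        "poly q x \<in> I"
      unfolding lead_ideal_def by blast
    have "poly (p - q) x \<in> I"
    proof (rule Suc.IH)
      show "\<forall>i. coeff (p - q) i \<in> R"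
        using R Suc.prems(1) q(2) by (simp add: is_subring_def is_subgroup_diff)
      show "\<forall>i\<ge>n. coeff (p - q) i = 0" using q(1,3) Suc.prems(2)
        by (metis Suc_leI coeff_diff diff_self le_neq_implies_less)
      show "poly (p - q) x \<in> J" using J Suc.prems(3) q(4) IJ
        by (auto simp: sub_ideal_def intro!: is_subgroup_diff)
    qed
    moreover have "poly p x = poly (p - q) x + poly q x" by simp
    ultimately show ?case using q(4) I by (metis sub_ideal_def is_subgroup_def)
  qed
  moreover have "\<forall>i\<ge>Suc (degree p). coeff p i = 0" for p :: "'a poly" by (simp add: coeff_eq_0)
  ultimately have "J \<subseteq> I" using J unfolding sub_ideal_def adjoin_def by blast
  with IJ show ?thesis by blast
qed

text \<open>The ideals \<open>?L n k\<close> grow in both indices. Their diagonal stabilizes at some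
  \<open>M\<close>, and each of the finitely many rows \<open>n < M\<close> stabilizes at some
  \<open>N n\<close>; beyond the maximum \<open>K\<close> of these numbers no row grows.\<close>

lemma Hilbert_basis:
  assumes R: "noetherian_subring R"
  shows "noetherian_subring (adjoin R x)"
  unfolding noetherian_subring_def
proof (intro conjI allI impI)
  have sR: "is_subring R" using R by (simp add: noetherian_subring_def)
  show "is_subring (adjoin R x)" by (rule is_subring_adjoin[OF sR])
  fix I assume id: "\<forall>n. sub_ideal (adjoin R x) (I n)" and inc: "incseq I"
  let ?L = "\<lambda>n k. lead_ideal R x n (I k)"
  have Lid: "sub_ideal R (?L n k)" for n k using sub_ideal_lead_ideal[OF sR] id by blast
  have Lk: "?L n k \<subseteq> ?L n k'" if "k \<le> k'" for n k k'
    by (rule lead_ideal_mono) (rule incseqD[OF inc that])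
  have Ln: "?L n k \<subseteq> ?L n' k" if "n \<le> n'" for n n' k
    using that by (induction rule: dec_induct) (use lead_ideal_Suc[OF sR] id in blast)+
  have stab: "\<exists>N. \<forall>n\<ge>N. J n = J N" if "\<And>n. sub_ideal R (J n)" "incseq J" for J
    using R that by (auto simp: noetherian_subring_def)
  have "\<exists>N. \<forall>n\<ge>N. ?L n n = ?L N N"
    by (rule stab) (use Lid Lk Ln in \<open>auto intro!: incseq_SucI\<close>, meson Lk Ln lessI less_imp_le subsetD)
  then obtain M where M: "\<And>n. n \<ge> M \<Longrightarrow> ?L n n = ?L M M" by blast
  have "\<exists>N. \<forall>k\<ge>N. ?L n k = ?L n N" for n
    by (rule stab) (use Lid Lk in \<open>auto intro!: incseq_SucI\<close>, meson Lk lessI less_imp_le subsetD)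
  then obtain N where N: "\<And>n k. k \<ge> N n \<Longrightarrow> ?L n k = ?L n (N n)" by metis
  define K where "K = Max (insert M (N ` {..<M}))"
  have KM: "K \<ge> M" and KN: "n < M \<Longrightarrow> K \<ge> N n" for n unfolding K_def by auto
  show "\<exists>N. \<forall>n\<ge>N. I n = I N"
  proof (intro exI allI impI)
    fix k assume k: "k \<ge> K"
    have "?L n k \<subseteq> ?L n K" for n
    proof (cases "n < M")
      case True
      then show ?thesis using N[of n k] N[of n K] KN[OF True] k by simp
    next
      case False
      \<comment> \<open>A row with \<open>n \<ge> M\<close> is squeezed: beyond \<open>M\<close> the
        diagonal is constant, and its value is already contained in \<open>?L n K\<close>.\<close>
      have "?L n k \<subseteq> ?L (max n k) (max n k)" using Lk Ln by (meson max.cobounded1 max.cobounded2 order_trans)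
      also have "\<dots> = ?L M M" using False by (intro M) simp
      also have "\<dots> \<subseteq> ?L n K" using Lk Ln False KM by (meson not_less order_trans)
      finally show ?thesis .
    qed
    then have "I K = I k"
      using lead_ideal_determines[OF sR] id incseqD[OF inc k] by blast
    then show "I k = I K" ..
  qed
qed

section \<open>The Noetherian property of finitely generated algebras\<close>

lemma noetherian_subring_field_image:
  fixes \<iota> :: "'k::field \<Rightarrow> 'b::comm_ring_1"
  assumes "algebra_map \<iota>"
  shows "noetherian_subring (range \<iota>)"
  unfolding noetherian_subring_def
proof (intro conjI allI impI)
  have h: "\<iota> 1 = 1" "\<And>x y. \<iota> (x + y) = \<iota> x + \<iota> y" "\<And>x y. \<iota> (x * y) = \<iota> x * \<iota> y"
    using assms by (auto simp: algebra_map_def)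
  have h0: "\<iota> 0 = 0" using h(2)[of 0 0] by simp
  have hm: "\<iota> (- x) = - \<iota> x" for x 
  proof -
    have "\<iota> x + \<iota> (- x) = 0" using h(2)[of x "- x"] h0 by simp
    then show ?thesis by (rule minus_unique[symmetric])
  qed
  show "is_subring (range \<iota>)"
  proof -
    have "0 \<in> range \<iota>" "1 \<in> range \<iota>" using h0 h(1) by (metis rangeI)+
    moreover have "\<iota> x + \<iota> y \<in> range \<iota>" "\<iota> x * \<iota> y \<in> range \<iota>" "- \<iota> x \<in> range \<iota>" for x y
      using rangeI[of \<iota> "x + y"] rangeI[of \<iota> "x * y"] rangeI[of \<iota> "- x"]
      unfolding h(2,3) hm by this+
    ultimately show ?thesis unfolding is_subring_def is_subgroup_def by (intro conjI ballI) auto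
  qed
  fix I :: "nat \<Rightarrow> 'b set"
  assume id: "\<forall>n. sub_ideal (range \<iota>) (I n)" and inc: "incseq I"
  \<comment> \<open>A nonzero ideal of a field is the whole field, so the chain is constant from its
    first nonzero member on.\<close>
  have full: "I n = range \<iota>" if y: "y \<in> I n" "y \<noteq> 0" for n y
  proof -
    have nI: "sub_ideal (range \<iota>) (I n)" using id by blast
    then have "I n \<subseteq> range \<iota>" by (simp add: sub_ideal_def)
    then obtain c where c: "y = \<iota> c" using y(1) by blast
    then have "c \<noteq> 0" using y h0 by auto
    have "\<iota> a \<in> I n" for a
    proof -
      have "\<iota> (a / c) * y \<in> I n" using nI y(1) by (simp add: sub_ideal_def)
      moreover have "\<iota> (a / c) * y = \<iota> a" unfolding c h(3)[symmetric] using \<open>c \<noteq> 0\<close> by simp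
      ultimately show ?thesis by simp
    qed
    then have "range \<iota> \<subseteq> I n" by auto
    then show ?thesis using \<open>I n \<subseteq> range \<iota>\<close> by (rule subset_antisym[rotated])
  qed
  show "\<exists>N. \<forall>n\<ge>N. I n = I N"
  proof (cases "\<exists>n. \<exists>y\<in>I n. y \<noteq> 0")
    case True
    then obtain n y where n: "y \<in> I n" "y \<noteq> 0" by blast
    then have "I m = range \<iota>" if "m \<ge> n" for m using full incseqD[OF inc that] by blast
    then show ?thesis by (metis order_refl)
  next
    case False
    moreover have "0 \<in> I n" for n using id by (auto simp: sub_ideal_def is_subgroup_def)
    ultimately have "I n = {0}" for n by blast
    then show ?thesis by simp
  qed
qed

text \<open>Adjoin the generators one at a time to the image of the field; the Noetherian subring so
  obtained contains all generators, hence is the whole ring.\<close>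

lemma fg_algebra_noetherian:
  fixes \<iota> :: "'k::field \<Rightarrow> 'b::comm_ring_1"
  assumes "fg_algebra \<iota>"
  shows "noetherian_subring (UNIV :: 'b set)"
proof -
  obtain S where S: "finite S" "\<Inter>{R. is_subring R \<and> range \<iota> \<subseteq> R \<and> S \<subseteq> R} = UNIV"
    and \<iota>: "algebra_map \<iota>"
    using assms by (auto simp: fg_algebra_def)
  have "\<exists>R. noetherian_subring R \<and> range \<iota> \<subseteq> R \<and> S \<subseteq> R" using S(1)
  proof (induction S rule: finite_induct)
    case empty
    then show ?case using noetherian_subring_field_image[OF \<iota>] by blast
  next
    case (insert x S)
    then obtain R where R: "noetherian_subring R" "range \<iota> \<subseteq> R" "S \<subseteq> R" by blast
    have "0 \<in> R" "1 \<in> R"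
      using R(1) by (auto simp: noetherian_subring_def is_subring_def is_subgroup_def)
    then show ?case using Hilbert_basis[OF R(1), of x] adjoin_superset[of R x] adjoin_self[of R x] R
      by blast
  qed
  then obtain R where R: "noetherian_subring R" "range \<iota> \<subseteq> R" "S \<subseteq> R" by blast
  then have "UNIV \<subseteq> R" using S(2) by (auto simp: noetherian_subring_def)
  then have "R = UNIV" by blast
  then show ?thesis using R(1) by simp
qed

section \<open>Height one primes of normal Noetherian domains\<close>

lemma is_idealD:
  assumes "is_ideal I"
  shows "0 \<in> I" "x \<in> I \<Longrightarrow> y \<in> I \<Longrightarrow> x + y \<in> I" "x \<in> I \<Longrightarrow> - x \<in> I" "x \<in> I \<Longrightarrow> r * x \<in> I"
    "x \<in> I \<Longrightarrow> x * r \<in> I"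
  using assms by (auto simp: is_ideal_def is_subgroup_def mult.commute)

lemma is_prime_idealD:
  assumes "is_prime_ideal P"
  shows "is_ideal P" "1 \<notin> P" "x * y \<in> P \<Longrightarrow> x \<in> P \<or> y \<in> P" "x ^ n \<in> P \<Longrightarrow> x \<in> P"
proof -
  show P: "is_ideal P" and p: "x * y \<in> P \<Longrightarrow> x \<in> P \<or> y \<in> P" for x y
    using assms by (auto simp: is_prime_ideal_def)
  show 1: "1 \<notin> P" using is_idealD(4)[OF P, of 1] assms by (auto simp: is_prime_ideal_def)
  show "x ^ n \<in> P \<Longrightarrow> x \<in> P" by (induction n) (use 1 p in auto)
qed

lemma sub_ideal_UNIV [simp]: "sub_ideal UNIV I \<longleftrightarrow> is_ideal I"
  by (auto simp: sub_ideal_def is_ideal_def)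

lemma noetherian_ascending:
  fixes I :: "nat \<Rightarrow> 'b::comm_ring_1 set"
  assumes "noetherian_subring (UNIV :: 'b set)" "\<And>n. is_ideal (I n)" "incseq I"
  obtains N where "\<And>n. n \<ge> N \<Longrightarrow> I n = I N"
proof -
  have "\<exists>N. \<forall>n\<ge>N. I n = I N" using assms by (auto simp: noetherian_subring_def)
  then show thesis using that by blast
qed

text \<open>Otherwise each member of \<open>F\<close> is strictly contained in another one, and
  iterating such a choice from \<open>I0\<close> yields a strictly increasing chain.\<close>

lemma noetherian_maximal_ideal:
  fixes F :: "'b::comm_ring_1 set set"
  assumes N: "noetherian_subring (UNIV :: 'b set)"
    and I: "\<And>I. I \<in> F \<Longrightarrow> is_ideal I" and "I0 \<in> F"
  obtains M where "M \<in> F" "\<And>J. J \<in> F \<Longrightarrow> M \<subseteq> J \<Longrightarrow> J = M"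
proof (rule ccontr)
  assume "\<not> thesis"
  with that have "\<And>M. M \<in> F \<Longrightarrow> \<exists>J\<in>F. M \<subset> J" by blast
  then obtain g where g: "\<And>M. M \<in> F \<Longrightarrow> g M \<in> F \<and> M \<subset> g M" by metis
  define I where "I n = (g ^^ n) I0" for n
  have F: "I n \<in> F" for n by (induction n) (use g \<open>I0 \<in> F\<close> in \<open>auto simp: I_def\<close>)
  have less: "I n \<subset> I (Suc n)" for n using g[OF F[of n]] by (simp add: I_def)
  obtain k where "\<And>n. n \<ge> k \<Longrightarrow> I n = I k"
    using noetherian_ascending[OF N, of I] assms(2) F less by (metis incseq_SucI psubset_imp_subset)
  then show False using less[of k] by (metis le_SucI order_refl psubsetE)
qed

text \<open>The ideals \<open>(p, z p, \<dots>, z\<^sup>n p)\<close> stabilize, which yields a monic equation for \<open>z\<close>.\<close>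

lemma normal_noetherian_completely_integrally_closed:
  fixes z :: "'b::idom fract"
  assumes N: "noetherian_subring (UNIV :: 'b set)" and normal: "normal_domain TYPE('b)"
    and "p \<noteq> 0" and zp: "\<And>n. z ^ n * to_fract p \<in> range to_fract"
  shows "z \<in> range to_fract"
proof -
  \<comment> \<open>The span of \<open>p, z p, ..., z^n p\<close> over the ring, pulled back along
    \<open>to_fract\<close>.\<close>
  define I where "I n = {y. \<exists>q. (\<forall>i>n. coeff q i = 0) \<and> to_fract y = poly (map_poly to_fract q) z * to_fract p}"
    for n :: nat
  have id: "is_ideal (I n)" for n
    unfolding is_ideal_def is_subgroup_def
  proof (intro conjI ballI allI)
    show "0 \<in> I n" by (auto simp: I_def intro!: exI[of _ 0])
    fix x y r
    assume x: "x \<in> I n"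
    then obtain q where q: "\<forall>i>n. coeff q i = 0" "to_fract x = poly (map_poly to_fract q) z * to_fract p"
      by (auto simp: I_def)
    have mm: "map_poly to_fract (- q) = - map_poly to_fract q"
      using fract_poly_diff[of 0 q] by simp
    show "- x \<in> I n" unfolding I_def using q mm by (auto intro!: exI[of _ "- q"])
    show "r * x \<in> I n" unfolding I_def using q by (auto intro!: exI[of _ "smult r q"])
    assume "y \<in> I n"
    then obtain q' where q': "\<forall>i>n. coeff q' i = 0" "to_fract y = poly (map_poly to_fract q') z * to_fract p"
      by (auto simp: I_def)
    show "x + y \<in> I n" unfolding I_def using q q' by (auto intro!: exI[of _ "q + q'"] simp: algebra_simps)
  qed
  have "incseq I" by (rule incseq_SucI) (unfold I_def, blast intro: Suc_lessD)
  then obtain k where k: "\<And>n. n \<ge> k \<Longrightarrow> I n = I k" using noetherian_ascending[OF N, of I] id by blast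
  obtain y where y: "z ^ Suc k * to_fract p = to_fract y" using zp[of "Suc k"] by blast
  have "map_poly to_fract (monom 1 (Suc k)) = (monom 1 (Suc k) :: 'b fract poly)"
    by (simp add: map_poly_monom)
  then have "y \<in> I (Suc k)"
    using y by (auto simp: I_def poly_monom coeff_monom intro!: exI[of _ "monom 1 (Suc k)"])
  then have "y \<in> I k" using k[of "Suc k"] by simp
  then obtain q where q: "\<forall>i>k. coeff q i = 0" "to_fract y = poly (map_poly to_fract q) z * to_fract p"
    by (auto simp: I_def)
  \<comment> \<open>Membership in \<open>I k\<close> rewrites \<open>z^(k+1) p\<close> as
    \<open>q(z) p\<close> with \<open>degree q \<le> k\<close>; cancelling \<open>p\<close> gives
    the monic equation.\<close>
  have eq: "z ^ Suc k = poly (map_poly to_fract q) z" using y q(2) \<open>p \<noteq> 0\<close> by simp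
  have dq: "degree q < degree (monom (1::'b) (Suc k))"
    using q(1) by (simp add: degree_monom_eq degree_le less_Suc_eq_le)
  have "lead_coeff (monom 1 (Suc k) - q) = 1"
    using dq by (metis lead_coeff_monom degree_minus diff_conv_add_uminus lead_coeff_add_le add.commute)
  moreover have "poly (map_poly to_fract (monom 1 (Suc k) - q)) z = 0"
    using eq by (simp add: map_poly_monom poly_monom)
  ultimately have "integral_elt z" unfolding integral_elt_def by blast
  then show ?thesis using normal by (simp add: normal_domain_def)
qed

lemma to_fract_divide_mult:
  assumes "w * y = p * v" "p \<noteq> 0"
  shows "to_fract w / to_fract p * to_fract y = to_fract v"
proof -
  have "to_fract w * to_fract y = to_fract p * to_fract v" using assms(1) by (metis to_fract_mult)
  then show ?thesis using assms(2) by (simp add: field_simps)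
qed

text \<open>The chain \<open>{0} \<subset> P\<close> gives height at least one. In a chain of two or
  more steps ending at \<open>P\<close>, the last but one member would be a nonzero prime strictly
  inside \<open>P\<close>.\<close>

lemma Spec1_minimal_nonzero:
  fixes P :: "'b::idom set"
  assumes P: "is_prime_ideal P" and "P \<noteq> {0}"
    and min: "\<And>Q. is_prime_ideal Q \<Longrightarrow> Q \<noteq> {0} \<Longrightarrow> Q \<subseteq> P \<Longrightarrow> Q = P"
  shows "P \<in> Spec1"
proof -
  have 0: "is_prime_ideal {0::'b}"
    
  proof -
    have "{0::'b} \<noteq> UNIV" by (metis UNIV_I singletonD zero_neq_one)
    then show ?thesis by (simp add: is_prime_ideal_def is_ideal_def is_subgroup_def)
  qed
  have zP: "0 \<in> P" using is_idealD(1)[OF is_prime_idealD(1)[OF P]] .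
  let ?S = "{enat n | n. \<exists>c :: nat \<Rightarrow> 'b set.
     (\<forall>i\<le>n. is_prime_ideal (c i)) \<and> (\<forall>i<n. c i \<subset> c (Suc i)) \<and> c n = P}"
  have "\<exists>c :: nat \<Rightarrow> 'b set. (\<forall>i\<le>1. is_prime_ideal (c i)) \<and> (\<forall>i<1. c i \<subset> c (Suc i)) \<and> c 1 = P"
    using 0 P \<open>P \<noteq> {0}\<close> zP by (intro exI[of _ "\<lambda>i. if i = 0 then {0} else P"]) auto
  then have "enat 1 \<in> ?S" by blast
  then have "enat 1 \<le> Sup ?S" by (rule Sup_upper)
  moreover have "Sup ?S \<le> enat 1"
  proof (rule Sup_least)
    fix m assume "m \<in> ?S"
    then obtain n c where m: "m = enat n" and c: "\<And>i. i \<le> n \<Longrightarrow> is_prime_ideal (c i)"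
      "\<And>i. i < n \<Longrightarrow> c i \<subset> c (Suc i)" "c n = P" by blast
    have "n \<le> 1"
    proof (rule ccontr)
      assume "\<not> n \<le> 1"
      then obtain k where k: "n = Suc (Suc k)" by (metis One_nat_def Suc_le_mono le0 not0_implies_Suc)
      have "c k \<subset> c (Suc k)" "c (Suc k) \<subset> P" using c(2)[of k] c(2)[of "Suc k"] c(3) k by auto
      moreover have "0 \<in> c k" using is_idealD(1)[OF is_prime_idealD(1)[OF c(1)[of k]]] k by simp
      ultimately have "c (Suc k) \<noteq> {0}" by (auto simp: psubset_eq subset_singleton_iff)
      then show False using min[OF c(1)[of "Suc k"]] \<open>c (Suc k) \<subset> P\<close> k by auto
    qed
    then show "m \<le> enat 1" using m by simp
  qed
  ultimately have "height P = 1" unfolding height_def by (simp add: one_enat_def)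
  then show ?thesis using P by (simp add: Spec1_def)
qed

text \<open>In the localization at \<open>P\<close> the element \<open>w\<close> is a unit, so
  \<open>p\<close> generates the maximal ideal. If a nonzero prime \<open>Q\<close> inside
  \<open>P\<close> missed \<open>p\<close>, then \<open>w/p\<close> would map \<open>Q\<close> into
  itself, hence lie in the ring by complete integral closedness, and \<open>w\<close> would be a
  multiple of \<open>p\<close>. Once \<open>p\<close> lies in \<open>Q\<close>, so does
  \<open>w * q\<close> for every \<open>q\<close> in \<open>P\<close>.\<close>

lemma height_one_of_locally_principal:
  fixes P :: "'b::idom set"
  assumes N: "noetherian_subring (UNIV :: 'b set)" and normal: "normal_domain TYPE('b)"
    and P: "is_prime_ideal P" and p: "p \<in> P" "p \<noteq> 0" and w: "w \<notin> P"
    and pw: "\<And>q. q \<in> P \<Longrightarrow> p dvd w * q"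
  shows "P \<in> Spec1"
proof (rule Spec1_minimal_nonzero[OF P])
  show "P \<noteq> {0}" using p by blast
  fix Q assume Q: "is_prime_ideal Q" "Q \<noteq> {0}" "Q \<subseteq> P"
  note Qi = is_prime_idealD(1)[OF Q(1)]
  have wQ: "w \<notin> Q" using w Q(3) by blast
  have "p \<in> Q"
  proof (rule ccontr)
    assume pQ: "p \<notin> Q"
    obtain f where f: "f \<in> Q" "f \<noteq> 0" using Q(2) is_idealD(1)[OF Qi] by blast
    have "\<exists>y\<in>Q. (to_fract w / to_fract p) ^ n * to_fract f = to_fract y" for n
    proof (induction n)
      case (Suc n)
      then obtain y where y: "y \<in> Q" "(to_fract w / to_fract p) ^ n * to_fract f = to_fract y" by blast
      obtain v where v: "w * y = p * v" using pw[of y] y(1) Q(3) by (auto elim: dvdE)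
      have "p * v \<in> Q" unfolding v[symmetric] by (rule is_idealD(4)[OF Qi y(1)])
      then have "v \<in> Q" using pQ is_prime_idealD(3)[OF Q(1)] by blast
      moreover have "(to_fract w / to_fract p) ^ Suc n * to_fract f = to_fract v"
        using to_fract_divide_mult[OF v p(2)] y(2) by (simp only: power_Suc mult.assoc)
      ultimately show ?case by blast
    qed (use f in auto)
    then have "to_fract w / to_fract p \<in> range to_fract"
      using normal_noetherian_completely_integrally_closed[OF N normal f(2)] by blast
    then obtain r where "to_fract w / to_fract p = to_fract r" by blast
    then have "to_fract w = to_fract (r * p)" using p(2) by (simp add: field_simps)
    then have "w = r * p" by (simp only: to_fract_eq_iff)
    then show False using w is_idealD(4)[OF is_prime_idealD(1)[OF P] p(1)] by simp
  qed
  have "q \<in> Q" if q: "q \<in> P" for q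
  proof -
    obtain v where "w * q = p * v" using pw[OF q] by (auto elim: dvdE)
    then have "w * q \<in> Q" using is_idealD(5)[OF Qi \<open>p \<in> Q\<close>] by simp
    then show ?thesis using wQ is_prime_idealD(3)[OF Q(1)] by blast
  qed
  then show "Q = P" using Q(3) by blast
qed

text \<open>A normal Noetherian domain is the intersection of its localizations at height one primes:
  a maximal element among the proper conductors \<open>(b : c)\<close> containing \<open>(b : a)\<close> is a prime that
  becomes principal after localization.\<close>

lemma dvd_if_locally_dvd_in_height_one:
  fixes a b :: "'b::idom"
  assumes N: "noetherian_subring (UNIV :: 'b set)" and normal: "normal_domain TYPE('b)"
    and "b \<noteq> 0" and loc: "\<And>P. P \<in> Spec1 \<Longrightarrow> \<exists>u. u \<notin> P \<and> b dvd u * a"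
  shows "b dvd a"
proof (rule ccontr)
  assume nd: "\<not> b dvd a"
  define C where "C c = {x. b dvd x * c}" for c
  define F where "F = {C c | c. \<not> b dvd c \<and> C a \<subseteq> C c}"
  have idC: "is_ideal (C c)" for c
    by (auto simp: is_ideal_def is_subgroup_def C_def distrib_right mult.assoc)
  obtain M where M: "M \<in> F" "\<And>J. J \<in> F \<Longrightarrow> M \<subseteq> J \<Longrightarrow> J = M"
  proof (rule noetherian_maximal_ideal[OF N, of F "C a"])
    show "C a \<in> F" using nd by (auto simp: F_def)
  qed (use idC in \<open>auto simp: F_def\<close>)
  then obtain c where c: "M = C c" "\<not> b dvd c" "C a \<subseteq> C c" by (auto simp: F_def)
  have prime: "is_prime_ideal M"
    unfolding is_prime_ideal_def
  proof (intro conjI allI impI)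
    show "is_ideal M" using idC c by simp
    have "1 \<notin> M" using c by (simp add: C_def)
    then show "M \<noteq> UNIV" by blast
    fix x y assume xy: "x * y \<in> M"
    show "x \<in> M \<or> y \<in> M"
    proof (rule disjCI)
      \<comment> \<open>The conductor of \<open>y * c\<close> is proper and contains
        \<open>M\<close>, so by maximality it equals \<open>M\<close>; and it contains
        \<open>x\<close>.\<close>
      assume "y \<notin> M"
      then have "\<not> b dvd y * c" using c by (simp add: C_def)
      moreover have "C c \<subseteq> C (y * c)" 
      proof
        fix x assume "x \<in> C c"
        then have "b dvd y * (x * c)" by (simp add: C_def)
        then show "x \<in> C (y * c)" by (simp add: C_def ac_simps)
      qed
      ultimately have "C (y * c) \<in> F" unfolding F_def using c(3) by blast
      then have "C (y * c) = M" using \<open>C c \<subseteq> C (y * c)\<close> c(1) M(2) by blast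
      then show "x \<in> M" using xy c by (auto simp: C_def mult.assoc)
    qed
  qed
  have bM: "b \<in> M" using c by (simp add: C_def)
  have cM: "\<exists>y. p * c = b * y" if "p \<in> M" for p using that c by (auto simp: C_def elim: dvdE)
  \<comment> \<open>If multiplication by \<open>c/b\<close> mapped \<open>M\<close> into itself,
    \<open>c/b\<close> would lie in the ring and \<open>b\<close> would divide \<open>c\<close>. So
    \<open>w = p c / b\<close> falls outside \<open>M\<close> for some \<open>p\<close> in
    \<open>M\<close>, and this pair shows that \<open>M\<close> is locally principal.\<close>
  have "\<exists>p\<in>M. \<exists>y. p * c = b * y \<and> y \<notin> M"
  proof (rule ccontr)
    assume con: "\<not> ?thesis"
    have "\<exists>y\<in>M. (to_fract c / to_fract b) ^ n * to_fract b = to_fract y" for n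
    proof (induction n)
      case 0
      show ?case using bM by (intro bexI[of _ b]) simp_all
    next
      case (Suc n)
      then obtain y where y: "y \<in> M" "(to_fract c / to_fract b) ^ n * to_fract b = to_fract y" by blast
      obtain v where v: "y * c = b * v" using cM[OF y(1)] by blast
      then have "v \<in> M" using con y(1) by blast
      moreover have "c * y = b * v" using v by (simp add: mult.commute)
      then have "(to_fract c / to_fract b) ^ Suc n * to_fract b = to_fract v"
        using to_fract_divide_mult[OF _ \<open>b \<noteq> 0\<close>, of c y v] y(2) by (simp only: power_Suc mult.assoc)
      ultimately show ?case by blast
    qed
    then have "to_fract c / to_fract b \<in> range to_fract"
      using normal_noetherian_completely_integrally_closed[OF N normal \<open>b \<noteq> 0\<close>] by blast
    then obtain r where "to_fract c / to_fract b = to_fract r" by blast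
    then have "to_fract c = to_fract (r * b)" using \<open>b \<noteq> 0\<close> by (simp add: field_simps)
    then have "c = r * b" by (simp only: to_fract_eq_iff)
    then show False using c(2) by simp
  qed
  then obtain p w where p: "p \<in> M" "p * c = b * w" "w \<notin> M" by blast
  have "p \<noteq> 0"
    using p \<open>b \<noteq> 0\<close> is_idealD(1)[OF is_prime_idealD(1)[OF prime]] by auto
  have "p dvd w * q" if q: "q \<in> M" for q
  proof -
    obtain v where v: "q * c = b * v" using cM[OF q] by blast
    have "c \<noteq> 0" using c(2) by auto
    have "b * c * (w * q) = b * c * (p * v)" using p(2) v by algebra
    then show ?thesis using \<open>b \<noteq> 0\<close> \<open>c \<noteq> 0\<close> by simp
  qed
  then have "M \<in> Spec1"
    using height_one_of_locally_principal[OF N normal prime p(1) \<open>p \<noteq> 0\<close> p(3)] by blast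
  then obtain u where "u \<notin> M" "b dvd u * a" using loc by blast
  then show False using c by (auto simp: C_def)
qed

section \<open>Homogeneous components\<close>

text \<open>The same sum as in \<open>torsion_quotient\<close>, so that torsion statements unfold
  directly to such multiples.\<close>

definition nmult :: "nat \<Rightarrow> 'g::ab_group_add \<Rightarrow> 'g" where
  "nmult n a = (\<Sum>_<n. a)"

lemma nmult_0 [simp]: "nmult 0 a = 0"
  by (simp add: nmult_def)

lemma nmult_Suc [simp]: "nmult (Suc n) a = a + nmult n a"
  by (simp add: nmult_def add.commute)

lemma nmult_add: "nmult n (a + b) = nmult n a + nmult n b"
  by (simp add: nmult_def sum.distrib)

lemma nmult_mem: "is_subgroup H \<Longrightarrow> a \<in> H \<Longrightarrow> nmult n a \<in> H"
  by (induction n) (auto simp: is_subgroup_def)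

lemma is_subgroupD:
  assumes "is_subgroup H"
  shows "0 \<in> H" "x \<in> H \<Longrightarrow> y \<in> H \<Longrightarrow> x + y \<in> H" "x \<in> H \<Longrightarrow> - x \<in> H" "x \<in> H \<Longrightarrow> y \<in> H \<Longrightarrow> x - y \<in> H"
  using assms is_subgroup_diff[OF assms] by (auto simp: is_subgroup_def)

text \<open>A submonoid of a torsion group is a group; here this is applied modulo \<open>H\<close>.\<close>

lemma monoid_meets_coset:
  fixes S :: "'g::ab_group_add set"
  assumes S: "0 \<in> S" "\<And>a b. a \<in> S \<Longrightarrow> b \<in> S \<Longrightarrow> a + b \<in> S"
    and H: "is_subgroup H" and tors: "\<And>a. a \<in> S \<Longrightarrow> \<exists>n>0. nmult n a \<in> H"
    and g: "g \<in> group_closure S"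
  obtains j where "j \<in> S" "g + j \<in> H"
proof -
  have "\<exists>a\<in>S. \<exists>b\<in>S. g = a - b" using g
  proof (induction rule: group_closure.induct)
    case (base s)
    then have "s \<in> S" using S by auto
    then show ?case using S(1) by (intro bexI[of _ s] bexI[of _ 0]) auto
  next
    case (diff s t)
    then obtain a b c d where "a \<in> S" "b \<in> S" "c \<in> S" "d \<in> S" "s = a - b" "t = c - d" by blast
    then show ?case using S(2) by (intro bexI[of _ "a + d"] bexI[of _ "b + c"]) auto
  qed
  then obtain a b where ab: "a \<in> S" "b \<in> S" "g = a - b" by blast
  obtain n where n: "n > 0" "nmult n a \<in> H" using tors[OF ab(1)] by blast
  then obtain m where m: "n = Suc m" by (cases n) auto
  \<comment> \<open>The witness is \<open>nmult m a + b\<close>: adding it to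
    \<open>g = a - b\<close> leaves \<open>nmult n a\<close>, because
    \<open>n = m + 1\<close>.\<close>
  have "nmult m a \<in> S" by (induction m) (use S ab in auto)
  then have "nmult m a + b \<in> S" using S ab by blast
  moreover have "g + (nmult m a + b) \<in> H" using ab n m by simp
  ultimately show thesis using that by blast
qed

lemma sum_support:
  assumes "finite I" "{i. f i \<noteq> 0} \<subseteq> I"
  shows "(\<Sum>i | f i \<noteq> 0. f i) = sum f I"
  using assms by (intro sum.mono_neutral_left) auto

definition hcomp :: "('g::ab_group_add \<Rightarrow> 'b::comm_ring_1 set) \<Rightarrow> 'b \<Rightarrow> 'g \<Rightarrow> 'b" where
  "hcomp B x = (THE f. (\<forall>i. f i \<in> B i) \<and> finite {i. f i \<noteq> 0} \<and> x = (\<Sum>i | f i \<noteq> 0. f i))"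

text \<open>In the application \<open>one_mem\<close> comes from \<open>\<iota> 1 = 1\<close> and
  \<open>range \<iota> \<subseteq> B 0\<close>.\<close>

locale graded_ring =
  fixes B :: "'g::ab_group_add \<Rightarrow> 'b::comm_ring_1 set"
  assumes grading: "is_grading B" and one_mem: "1 \<in> B 0"
begin

lemma subgroup_component: "is_subgroup (B i)"
  using grading by (simp add: is_grading_def)

lemmas component_mem = is_subgroupD[OF subgroup_component]

lemma mult_mem: "x \<in> B i \<Longrightarrow> y \<in> B j \<Longrightarrow> x * y \<in> B (i + j)"
  using grading by (simp add: is_grading_def)

lemma power_mem: "x \<in> B i \<Longrightarrow> x ^ n \<in> B (nmult n i)"
  by (induction n) (auto simp: one_mem mult_mem)

lemma ex1_decomposition:
  "\<exists>!f. (\<forall>i. f i \<in> B i) \<and> finite {i. f i \<noteq> 0} \<and> x = (\<Sum>i | f i \<noteq> 0. f i)"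
  using grading unfolding is_grading_def by blast

lemma hcomp_props:
  "hcomp B x i \<in> B i" "finite {i. hcomp B x i \<noteq> 0}" "x = (\<Sum>i | hcomp B x i \<noteq> 0. hcomp B x i)"
  using theI'[OF ex1_decomposition[of x]] unfolding hcomp_def[symmetric] by blast+

lemma hcomp_eqI:
  assumes "finite I" "\<And>i. f i \<in> B i" "\<And>i. i \<notin> I \<Longrightarrow> f i = 0" "x = sum f I"
  shows "hcomp B x = f"
  unfolding hcomp_def
proof (rule the1_equality[OF ex1_decomposition], intro conjI allI)
  have "{i. f i \<noteq> 0} \<subseteq> I" using assms(3) by blast
  then show "finite {i. f i \<noteq> 0}" "x = (\<Sum>i | f i \<noteq> 0. f i)"
    using assms(1,4) sum_support[of I f] finite_subset by auto
qed (rule assms(2))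

lemma sum_hcomp:
  assumes "finite I" "\<And>i. hcomp B x i \<noteq> 0 \<Longrightarrow> i \<in> I"
  shows "sum (hcomp B x) I = x"
  using hcomp_props(3)[of x, symmetric] sum_support[of I "hcomp B x"] assms by (auto simp: subset_iff)

lemma hcomp_homogeneous:
  assumes "x \<in> B i"
  shows "hcomp B x = (\<lambda>j. if j = i then x else 0)"
  by (rule hcomp_eqI[of "{i}"]) (use assms component_mem in auto)

lemma hcomp_0 [simp]: "hcomp B 0 i = 0"
  by (simp add: hcomp_homogeneous[of 0 0] component_mem)

lemma hcomp_add: "hcomp B (x + y) i = hcomp B x i + hcomp B y i"
proof -
  let ?I = "{i. hcomp B x i \<noteq> 0} \<union> {i. hcomp B y i \<noteq> 0}"
  have "sum (hcomp B x) ?I = x" "sum (hcomp B y) ?I = y"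
    by (rule sum_hcomp; use hcomp_props(2) in auto)+
  then have "hcomp B (x + y) = (\<lambda>i. hcomp B x i + hcomp B y i)"
    by (intro hcomp_eqI[of ?I]) (use hcomp_props component_mem in \<open>auto simp: sum.distrib\<close>)
  then show ?thesis by simp
qed

text \<open>Multiplication by \<open>z\<close> translates degrees by \<open>k\<close>, so the
  translated products decompose \<open>z * x\<close>, and decompositions are unique.\<close>

lemma hcomp_mult:
  assumes "z \<in> B k"
  shows "hcomp B (z * x) (k + i) = z * hcomp B x i"
proof -
  let ?I = "{i. hcomp B x i \<noteq> 0}"
  have "z * x = (\<Sum>i\<in>?I. z * hcomp B x i)"
    using hcomp_props(3)[of x] by (simp add: sum_distrib_left[symmetric])
  also have "\<dots> = (\<Sum>j\<in>(+) k ` ?I. z * hcomp B x (j - k))"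
    by (subst sum.reindex) auto
  finally have "hcomp B (z * x) = (\<lambda>j. z * hcomp B x (j - k))"
  proof (intro hcomp_eqI[of "(+) k ` ?I"])
    show "finite ((+) k ` ?I)" using hcomp_props(2) by blast
    show "z * hcomp B x (i - k) \<in> B i" for i
      using mult_mem[OF assms hcomp_props(1), of x "i - k"] by simp
    show "z * hcomp B x (i - k) = 0" if "i \<notin> (+) k ` ?I" for i
      using that by (metis (mono_tags, lifting) add_diff_eq diff_add_cancel add.commute image_eqI mem_Collect_eq mult_zero_right)
  qed
  then show ?thesis by simp
qed

lemma homogeneous_induct [consumes 0, case_names zero add homogeneous]:
  assumes "P 0" "\<And>x y. P x \<Longrightarrow> P y \<Longrightarrow> P (x + y)" "\<And>x i. x \<in> B i \<Longrightarrow> P x"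
  shows "P x"
proof -
  have "P (hcomp B x i)" for i by (rule assms(3)[OF hcomp_props(1)])
  then have "P (\<Sum>i\<in>I. hcomp B x i)" for I
    by (induction I rule: infinite_finite_induct) (use assms(1,2) in auto)
  then show ?thesis using hcomp_props(3)[of x] by metis
qed

lemma subring_of_degrees_iff: "x \<in> subring_of_degrees B H \<longleftrightarrow> (\<forall>i. hcomp B x i \<noteq> 0 \<longrightarrow> i \<in> H)"
proof
  assume "x \<in> subring_of_degrees B H"
  then obtain I f where I: "x = (\<Sum>i\<in>I. f i)" "finite I" "I \<subseteq> H" "\<And>i. i \<in> I \<Longrightarrow> f i \<in> B i"
    unfolding subring_of_degrees_def by blast
  have "hcomp B x = (\<lambda>i. if i \<in> I then f i else 0)"
    by (rule hcomp_eqI[of I]) (use I component_mem in auto)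
  then show "\<forall>i. hcomp B x i \<noteq> 0 \<longrightarrow> i \<in> H" using I(3) by auto
next
  assume "\<forall>i. hcomp B x i \<noteq> 0 \<longrightarrow> i \<in> H"
  then show "x \<in> subring_of_degrees B H"
    unfolding subring_of_degrees_def using hcomp_props[of x]
    by (intro CollectI exI[of _ "{i. hcomp B x i \<noteq> 0}"] exI[of _ "hcomp B x"]) auto
qed

lemma component_subset_subring_of_degrees: "i \<in> H \<Longrightarrow> B i \<subseteq> subring_of_degrees B H"
  by (auto simp: subring_of_degrees_iff hcomp_homogeneous)

text \<open>The addition case also provides membership of both summands, because a derivation of the
  subring is additive only on its members.\<close>

lemma subring_of_degrees_induct [consumes 1, case_names zero add homogeneous]:
  assumes "x \<in> subring_of_degrees B H" and "P 0"
    and add: "\<And>x y. x \<in> subring_of_degrees B H \<Longrightarrow> y \<in> subring_of_degrees B H \<Longrightarrow> P x \<Longrightarrow> P y \<Longrightarrow> P (x + y)"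
    and hom: "\<And>x i. i \<in> H \<Longrightarrow> x \<in> B i \<Longrightarrow> P x"
  shows "P x"
proof -
  let ?A = "subring_of_degrees B H"
  have "sum (hcomp B x) I \<in> ?A \<and> P (sum (hcomp B x) I)" if "I \<subseteq> {i. hcomp B x i \<noteq> 0}" for I
    using that
  proof (induction I rule: infinite_finite_induct)
    case (insert i I)
    then have i: "i \<in> H" using assms(1) by (auto simp: subring_of_degrees_iff)
    then have "hcomp B x i \<in> ?A" using component_subset_subring_of_degrees hcomp_props(1) by blast
    moreover from this have "hcomp B x i + sum (hcomp B x) I \<in> ?A"
      using insert by (auto simp: subring_of_degrees_iff hcomp_add) (metis add_0)
    ultimately show ?case using insert add hom[OF i hcomp_props(1)] by auto
  qed (use \<open>P 0\<close> in \<open>auto simp: subring_of_degrees_iff\<close>)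
  then show ?thesis using hcomp_props(3)[of x] by (metis order_refl)
qed

lemma is_subring_subring_of_degrees:
  assumes H: "is_subgroup H"
  shows "is_subring (subring_of_degrees B H)" (is "is_subring ?A")
proof -
  note AD = is_subgroupD[OF H]
  have z: "0 \<in> ?A" by (simp add: subring_of_degrees_iff)
  have add: "x + y \<in> ?A" if "x \<in> ?A" "y \<in> ?A" for x y
    using that by (auto simp: subring_of_degrees_iff hcomp_add) (metis add_0)
  have hom: "x \<in> ?A" if "x \<in> B i" "i \<in> H" for x i
    using component_subset_subring_of_degrees that by blast
  have "- x \<in> ?A" if "x \<in> ?A" for x
    using that
  proof (induction rule: subring_of_degrees_induct)
    case (add x y)
    then show ?case using \<open>\<And>y x. x \<in> ?A \<Longrightarrow> y \<in> ?A \<Longrightarrow> x + y \<in> ?A\<close>[of "- x" "- y"] by (simp add: add.commute)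
  next
    case (homogeneous x i)
    then show ?case using hom component_mem(3) by blast
  qed (use z in simp)
  moreover have "x * y \<in> ?A" if "x \<in> ?A" "y \<in> ?A" for x y
    using that(1)
  proof (induction rule: subring_of_degrees_induct)
    case (homogeneous x i)
    show ?case using that(2)
    proof (induction rule: subring_of_degrees_induct)
      case (homogeneous y j)
      then show ?case using \<open>i \<in> H\<close> \<open>x \<in> B i\<close> hom[OF mult_mem] AD by blast
    qed (use z add in \<open>auto simp: distrib_left\<close>)
  qed (use z add in \<open>auto simp: distrib_right\<close>)
  moreover have "1 \<in> ?A" using one_mem hom AD by blast
  ultimately show ?thesis using z add by (auto simp: is_subring_def is_subgroup_def)
qed

end

section \<open>Locally nilpotent derivations\<close>

locale derivation_on =
  fixes A :: "'b::idom set" and D :: "'b \<Rightarrow> 'b"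
  assumes subring: "is_subring A" and derivation: "is_derivation A D"
begin

lemma subring_mem:
  "0 \<in> A" "1 \<in> A" "x \<in> A \<Longrightarrow> y \<in> A \<Longrightarrow> x + y \<in> A" "x \<in> A \<Longrightarrow> y \<in> A \<Longrightarrow> x * y \<in> A" "x \<in> A \<Longrightarrow> - x \<in> A"
  using subring by (auto simp: is_subring_def is_subgroup_def)

lemma power_mem_subring: "x \<in> A \<Longrightarrow> x ^ n \<in> A"
  by (induction n) (auto intro: subring_mem)

lemma of_nat_mem_subring: "of_nat n \<in> A"
  by (induction n) (auto intro: subring_mem)

lemma D_mem: "x \<in> A \<Longrightarrow> D x \<in> A"
  and D_outside: "x \<notin> A \<Longrightarrow> D x = 0"
  and D_add: "x \<in> A \<Longrightarrow> y \<in> A \<Longrightarrow> D (x + y) = D x + D y"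
  and D_mult: "x \<in> A \<Longrightarrow> y \<in> A \<Longrightarrow> D (x * y) = D x * y + x * D y"
  using derivation by (auto simp: is_derivation_def)

lemma D_0 [simp]: "D 0 = 0"
  using D_add[OF subring_mem(1,1)] by (metis add_cancel_right_right add_0)

lemma D_1 [simp]: "D 1 = 0"
  using D_mult[OF subring_mem(2,2)] by (metis add_cancel_right_right mult_1 mult_1_right)

lemma D_of_nat [simp]: "D (of_nat n) = 0"
  by (induction n) (simp_all add: D_add subring_mem of_nat_mem_subring)

text \<open>The extra factor \<open>x\<close> avoids the exponent \<open>n - 1\<close>, so the
  formula is uniform in \<open>n\<close>, including \<open>n = 0\<close>.\<close>

lemma D_power: "x \<in> A \<Longrightarrow> D (x ^ n) * x = of_nat n * x ^ n * D x"
proof (induction n)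
  case (Suc n)
  then have "D (x ^ Suc n) * x = D x * x ^ Suc n + x * (D (x ^ n) * x)"
    by (simp add: D_mult power_mem_subring algebra_simps)
  then show ?case using Suc by (simp add: algebra_simps)
qed simp

lemma funpow_mem: "x \<in> A \<Longrightarrow> (D ^^ n) x \<in> A"
  by (induction n) (auto intro: D_mem)

lemma funpow_0 [simp]: "(D ^^ n) 0 = 0"
  by (induction n) auto

lemma funpow_add: "x \<in> A \<Longrightarrow> y \<in> A \<Longrightarrow> (D ^^ n) (x + y) = (D ^^ n) x + (D ^^ n) y"
  by (induction n) (auto simp: D_add funpow_mem)

lemma funpow_kernel_mult: "k \<in> A \<Longrightarrow> D k = 0 \<Longrightarrow> x \<in> A \<Longrightarrow> (D ^^ n) (k * x) = k * (D ^^ n) x"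
  by (induction n) (auto simp: D_mult funpow_mem)

lemma funpow_zero_mono:
  assumes "(D ^^ m) x = 0" "m \<le> n"
  shows "(D ^^ n) x = 0"
proof -
  have "(D ^^ (n - m + m)) x = (D ^^ (n - m)) ((D ^^ m) x)" by (simp add: Nat.funpow_add)
  then show ?thesis using assms by simp
qed

text \<open>In Leibniz' formula only the term with \<open>m\<close> derivatives on \<open>a\<close>
  and \<open>n\<close> on \<open>b\<close> survives. The induction differentiates the product once,
  and Pascal's rule adds the two binomial coefficients.\<close>

lemma funpow_top_mult:
  assumes "a \<in> A" "b \<in> A" "(D ^^ Suc m) a = 0" "(D ^^ Suc n) b = 0"
  shows "(D ^^ (m + n)) (a * b) = of_nat ((m + n) choose m) * ((D ^^ m) a * (D ^^ n) b)"
  using assms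
proof (induction "m + n" arbitrary: m n a b rule: less_induct)
  case less
  consider "m = 0" | "n = 0" | m' n' where "m = Suc m'" "n = Suc n'"
    by (metis not0_implies_Suc)
  then show ?case
  proof cases
    case 1
    then show ?thesis using less.prems by (simp add: funpow_kernel_mult)
  next
    case 2
    then show ?thesis using less.prems funpow_kernel_mult[of b a m] by (simp add: mult.commute)
  next
    case 3
    have "(D ^^ (m + n)) (a * b) = (D ^^ Suc (m' + n)) (a * b)" using 3 by simp
    also have "\<dots> = (D ^^ (m' + n)) (D a * b + a * D b)"
      using less.prems(1,2) by (simp only: funpow_Suc_right o_apply D_mult)
    also have "\<dots> = (D ^^ (m' + n)) (D a * b) + (D ^^ (m + n')) (a * D b)"
      using less.prems(1,2) 3 by (simp add: funpow_add D_mem subring_mem del: funpow.simps)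
    also have "(D ^^ (m' + n)) (D a * b) = of_nat ((m' + n) choose m') * ((D ^^ m) a * (D ^^ n) b)"
      using less.hyps[of m' n "D a" b] less.prems 3 D_mem by (simp add: funpow_swap1)
    also have "(D ^^ (m + n')) (a * D b) = of_nat ((m + n') choose m) * ((D ^^ m) a * (D ^^ n) b)"
      using less.hyps[of m n' a "D b"] less.prems 3 D_mem by (simp add: funpow_swap1)
    finally show ?thesis using 3 by (simp add: algebra_simps)
  qed
qed

lemma funpow_top_mult_Suc:
  assumes "a \<in> A" "b \<in> A" "(D ^^ Suc m) a = 0" "(D ^^ Suc n) b = 0"
  shows "(D ^^ Suc (m + n)) (a * b) = 0"
  using assms funpow_top_mult[OF assms]
  by (simp add: D_mult of_nat_mem_subring subring_mem funpow_mem)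

end

locale lnd_on = derivation_on A D for A :: "'b::idom set" and D +
  assumes nilpotent: "locally_nilpotent A D"
    and char_0: "n > 0 \<Longrightarrow> of_nat n \<noteq> (0::'b)"
begin

text \<open>The usual degree function of a locally nilpotent derivation, except that zero receives
  degree 0 instead of minus infinity; hence the nonzero conditions below.\<close>

definition deg :: "'b \<Rightarrow> nat" where
  "deg b = (LEAST n. (D ^^ Suc n) b = 0)"

lemma deg_eqI: "(D ^^ n) b \<noteq> 0 \<Longrightarrow> (D ^^ Suc n) b = 0 \<Longrightarrow> deg b = n"
  unfolding deg_def
  by (rule Least_equality) (simp, metis funpow_zero_mono not_less_eq_eq)

lemma deg_props:
  assumes "b \<in> A"
  shows "(D ^^ Suc (deg b)) b = 0" "b \<noteq> 0 \<Longrightarrow> (D ^^ deg b) b \<noteq> 0"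
proof -
  obtain n where "n > 0" "(D ^^ n) b = 0" using nilpotent assms by (auto simp: locally_nilpotent_def)
  then have "\<exists>n. (D ^^ Suc n) b = 0" by (metis Suc_pred)
  then show "(D ^^ Suc (deg b)) b = 0" unfolding deg_def by (rule LeastI_ex)
  show "(D ^^ deg b) b \<noteq> 0" if "b \<noteq> 0"
  proof (cases "deg b")
    case 0
    then show ?thesis using that by simp
  next
    case (Suc n)
    then show ?thesis unfolding deg_def using not_less_Least[of n "\<lambda>n. (D ^^ Suc n) b = 0"] by auto
  qed
qed

text \<open>In characteristic zero the binomial coefficient in \<open>funpow_top_mult\<close> is
  nonzero, so the product of the top derivatives survives.\<close>

lemma deg_mult:
  assumes "a \<in> A" "b \<in> A" "a \<noteq> 0" "b \<noteq> 0"
  shows "deg (a * b) = deg a + deg b"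
proof (rule deg_eqI)
  note a = deg_props[OF assms(1)] and b = deg_props[OF assms(2)]
  show "(D ^^ Suc (deg a + deg b)) (a * b) = 0"
    by (rule funpow_top_mult_Suc[OF assms(1,2) a(1) b(1)])
  have "of_nat ((deg a + deg b) choose deg a) \<noteq> (0::'b)" by (rule char_0) simp
  then show "(D ^^ (deg a + deg b)) (a * b) \<noteq> 0"
    using funpow_top_mult[OF assms(1,2) a(1) b(1)] a(2) b(2) assms by simp
qed

lemma deg_kernel: "D a = 0 \<Longrightarrow> deg a = 0"
  unfolding deg_def by (rule Least_equality) auto

lemma deg_power: "a \<in> A \<Longrightarrow> a \<noteq> 0 \<Longrightarrow> deg (a ^ n) = n * deg a"
  by (induction n) (auto simp: deg_mult power_mem_subring deg_kernel)

lemma deg_D: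
  assumes "a \<in> A" "D a \<noteq> 0"
  shows "deg a = Suc (deg (D a))"
  using deg_props[OF D_mem[OF assms(1)]] assms(2)
  by (intro deg_eqI) (auto simp: funpow_swap1)

end

section \<open>Extending derivations from Veronese subrings\<close>

text \<open>The form in which characteristic zero is passed on: it allows division by factorials and
  shows that positive integers lie outside every prime ideal.\<close>

definition rational_ring :: "'b::comm_ring_1 itself \<Rightarrow> bool" where
  "rational_ring _ \<longleftrightarrow> (\<forall>n>0. \<exists>v::'b. of_nat n * v = 1)"

lemma rational_ring_of_nat_neq_0:
  "rational_ring TYPE('b::idom) \<Longrightarrow> n > 0 \<Longrightarrow> of_nat n \<noteq> (0::'b)"
  unfolding rational_ring_def by (metis mult_zero_left zero_neq_one)

context graded_ring
begin

lemma of_nat_mem: "of_nat n \<in> B 0"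
  by (induction n) (use component_mem one_mem in auto)

lemma of_nat_mult_mem: "x \<in> B i \<Longrightarrow> of_nat n * x \<in> B i"
  using mult_mem[OF of_nat_mem] by force

definition extend_homogeneous :: "('b \<Rightarrow> 'b) \<Rightarrow> 'b \<Rightarrow> 'b" where
  "extend_homogeneous e x = (\<Sum>i | hcomp B x i \<noteq> 0. e (hcomp B x i))"

context
  fixes e :: "'b \<Rightarrow> 'b"
  assumes e_add: "\<And>i x y. x \<in> B i \<Longrightarrow> y \<in> B i \<Longrightarrow> e (x + y) = e x + e y"
begin

lemma e_0: "e 0 = 0"
  using e_add[of 0 0 0] component_mem(1) by (metis add_cancel_right_right add_0)

lemma extend_homogeneous_eq_sum:
  assumes "finite I" "{i. hcomp B x i \<noteq> 0} \<subseteq> I"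
  shows "extend_homogeneous e x = (\<Sum>i\<in>I. e (hcomp B x i))"
  unfolding extend_homogeneous_def using assms by (intro sum.mono_neutral_left) (auto simp: e_0)

lemma extend_homogeneous_homogeneous: "x \<in> B i \<Longrightarrow> extend_homogeneous e x = e x"
  by (subst extend_homogeneous_eq_sum[of "{i}"]) (auto simp: hcomp_homogeneous)

lemma extend_homogeneous_add:
  "extend_homogeneous e (x + y) = extend_homogeneous e x + extend_homogeneous e y"
proof -
  let ?I = "{i. hcomp B x i \<noteq> 0} \<union> {i. hcomp B y i \<noteq> 0} \<union> {i. hcomp B (x + y) i \<noteq> 0}"
  have "finite ?I" using hcomp_props(2) by simp
  then have "extend_homogeneous e z = (\<Sum>i\<in>?I. e (hcomp B z i))" if "z \<in> {x, y, x + y}" for z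
    using that by (intro extend_homogeneous_eq_sum) auto
  then show ?thesis by (simp add: hcomp_add e_add[OF hcomp_props(1) hcomp_props(1)] sum.distrib)
qed

lemma extend_homogeneous_derivation:
  assumes e_mult: "\<And>i j x y. x \<in> B i \<Longrightarrow> y \<in> B j \<Longrightarrow> e (x * y) = e x * y + x * e y"
  shows "is_derivation UNIV (extend_homogeneous e)" (is "is_derivation _ ?d")
proof -
  note add = extend_homogeneous_add
  have 0: "?d 0 = 0" by (simp add: extend_homogeneous_def)
  have "?d (x * y) = ?d x * y + x * ?d y" for x y
  proof (induction x rule: homogeneous_induct)
    case (homogeneous x i)
    show ?case
    proof (induction y rule: homogeneous_induct)
      case (homogeneous y j)
      show ?case
        using e_mult[OF \<open>x \<in> B i\<close> \<open>y \<in> B j\<close>] extend_homogeneous_homogeneous[OF \<open>x \<in> B i\<close>]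
          extend_homogeneous_homogeneous[OF \<open>y \<in> B j\<close>]
          extend_homogeneous_homogeneous[OF mult_mem[OF \<open>x \<in> B i\<close> \<open>y \<in> B j\<close>]] by simp
    qed (auto simp: 0 add algebra_simps)
  qed (auto simp: 0 add algebra_simps)
  then show ?thesis by (auto simp: is_derivation_def add)
qed

end

text \<open>An element has finitely many components, so a large iterate kills all of them at
  once.\<close>

lemma locally_nilpotent_UNIV_if_homogeneous:
  assumes D: "is_derivation UNIV D"
    and nil: "\<And>i x. x \<in> B i \<Longrightarrow> \<exists>n. (D ^^ n) x = 0"
  shows "locally_nilpotent UNIV D"
proof -
  have D_add: "D (x + y) = D x + D y" for x y using D by (simp add: is_derivation_def)
  have D_0: "D 0 = 0" using D_add[of 0 0] by (metis add_cancel_right_right add_0)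
  have D0: "(D ^^ n) 0 = 0" for n by (induction n) (auto simp: D_0)
  have add: "(D ^^ n) (x + y) = (D ^^ n) x + (D ^^ n) y" for n x y
    by (induction n) (auto simp: D_add)
  have mono: "(D ^^ (n + m)) x = 0" if "(D ^^ m) x = 0" for n m x
    using that by (simp add: funpow_add D0)
  have "\<exists>n. (D ^^ n) x = 0" for x
  proof (induction x rule: homogeneous_induct)
    case (add x y)
    then obtain m n where mn: "(D ^^ m) x = 0" "(D ^^ n) y = 0" by blast
    have "(D ^^ (m + n)) (x + y) = 0"
      using mono[OF mn(1), of n] mono[OF mn(2), of m] \<open>\<And>y x n. (D ^^ n) (x + y) = (D ^^ n) x + (D ^^ n) y\<close>
      by (simp add: add.commute)
    then show ?case by blast
  qed (use nil D0 in auto)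
  then show ?thesis unfolding locally_nilpotent_def
    using mono[of _ _ 1] by (metis add_gr_0 zero_less_one)
qed

end

text \<open>A component of \<open>y\<close> in a degree other than \<open>l\<close>, multiplied by
  \<open>z\<close>, is a component of \<open>z * y\<close> in a degree other than
  \<open>k + l\<close>, hence zero.\<close>

lemma (in graded_ring) cancel_homogeneous:
  fixes z :: 'b
  assumes nz: "\<And>y. z * y = 0 \<Longrightarrow> y = 0" and z: "z \<in> B k" and zy: "z * y \<in> B (k + l)"
  shows "y \<in> B l"
proof -
  have "hcomp B y i = 0" if "i \<noteq> l" for i
  proof (rule nz)
    have "z * hcomp B y i = hcomp B (z * y) (k + i)" by (simp add: hcomp_mult[OF z])
    also have "\<dots> = 0" using that by (simp add: hcomp_homogeneous[OF zy])
    finally show "z * hcomp B y i = 0" .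
  qed
  then have "y = sum (hcomp B y) {l}" by (subst sum_hcomp) auto
  then show ?thesis using hcomp_props(1)[of y l] by simp
qed

text \<open>The unique extension to the whole ring of a derivation of \<open>B\<^sup>(\<^sup>H\<^sup>)\<close>, expressed on homogeneous
  elements through the logarithmic derivative \<open>D(x\<^sup>n) / (n x\<^sup>n)\<close> of any power \<open>x\<^sup>n\<close> in the subring.\<close>

locale lnd_extension = graded_ring B + lnd_on "subring_of_degrees B H" D
  for B :: "'g::ab_group_add \<Rightarrow> 'b::idom set" and H :: "'g set" and D :: "'b \<Rightarrow> 'b" +
  fixes d :: 'g
  assumes H: "is_subgroup H" and d: "d \<in> H"
    and degree: "\<And>i x. i \<in> H \<Longrightarrow> x \<in> B i \<Longrightarrow> D x \<in> B (i + d)"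
    and torsion: "\<And>i x. x \<in> B i \<Longrightarrow> x \<noteq> 0 \<Longrightarrow> \<exists>n>0. nmult n i \<in> H"
    and noetherian: "noetherian_subring (UNIV :: 'b set)"
    and normal: "normal_domain TYPE('b)"
    and rational: "rational_ring TYPE('b)"
    and unit_degrees: "\<And>P i x. P \<in> Spec1 \<Longrightarrow> x \<in> B i \<Longrightarrow> x \<noteq> 0 \<Longrightarrow> i \<in> group_closure (MM B P)"
begin

abbreviation "A \<equiv> subring_of_degrees B H"

lemma component_A: "i \<in> H \<Longrightarrow> x \<in> B i \<Longrightarrow> x \<in> A"
  using component_subset_subring_of_degrees by blast

lemma power_A: "nmult n i \<in> H \<Longrightarrow> x \<in> B i \<Longrightarrow> x ^ n \<in> A"
  using component_A power_mem by blast

lemma ex_power_A: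
  assumes "x \<in> B i"
  shows "\<exists>n>0. x ^ n \<in> A"
proof (cases "x = 0")
  case True
  then show ?thesis using subring_mem(1) by (intro exI[of _ 1]) auto
qed (use torsion[OF assms] power_A assms in blast)

definition log_deriv :: "'b \<Rightarrow> 'b fract" where
  "log_deriv x = (let n = (SOME n. n > 0 \<and> x ^ n \<in> A) in to_fract (D (x ^ n)) / to_fract (of_nat n * x ^ n))"

text \<open>Two exponents \<open>n\<close> and \<open>m\<close> are compared through
  \<open>D (x ^ (n * m))\<close>, expanded once as a power of \<open>x ^ n\<close> and once as a
  power of \<open>x ^ m\<close>. So the choice made in \<open>log_deriv\<close> is
  immaterial.\<close>

lemma log_deriv_eq:
  assumes "x \<noteq> 0" "m > 0" "x ^ m \<in> A"
  shows "log_deriv x = to_fract (D (x ^ m)) / to_fract (of_nat m * x ^ m)"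
proof -
  define n where "n = (SOME n. n > 0 \<and> x ^ n \<in> A)"
  have n: "n > 0 \<and> x ^ n \<in> A" unfolding n_def by (rule someI_ex) (use assms in blast)
  let ?y = "D (x ^ (n * m))"
  have 1: "?y * x ^ n = of_nat m * x ^ (n * m) * D (x ^ n)"
    using D_power[of "x ^ n" m] n by (simp add: power_mult)
  have 2: "?y * x ^ m = of_nat n * x ^ (n * m) * D (x ^ m)"
    using D_power[of "x ^ m" n] assms(3) by (simp add: power_mult mult.commute[of n m])
  have "x ^ (n * m) * (D (x ^ n) * (of_nat m * x ^ m)) = (?y * x ^ n) * x ^ m"
    unfolding 1 by (simp add: ac_simps)
  also have "\<dots> = (?y * x ^ m) * x ^ n" by (simp add: ac_simps)
  also have "\<dots> = x ^ (n * m) * (D (x ^ m) * (of_nat n * x ^ n))"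
    unfolding 2 by (simp add: ac_simps)
  finally have "D (x ^ n) * (of_nat m * x ^ m) = D (x ^ m) * (of_nat n * x ^ n)"
    using assms(1) by simp
  then have "to_fract (D (x ^ n)) * to_fract (of_nat m * x ^ m) = to_fract (D (x ^ m)) * to_fract (of_nat n * x ^ n)"
    by (metis to_fract_mult)
  moreover have "to_fract (of_nat n * x ^ n) \<noteq> 0" "to_fract (of_nat m * x ^ m) \<noteq> 0"
    using n assms by (simp_all add: char_0 del: to_fract_mult)
  ultimately have "to_fract (D (x ^ n)) / to_fract (of_nat n * x ^ n) = to_fract (D (x ^ m)) / to_fract (of_nat m * x ^ m)"
    by (simp only: frac_eq_eq not_False_eq_True)
  then show ?thesis unfolding log_deriv_def n_def[symmetric] Let_def .
qed

lemma log_deriv_A: "x \<in> A \<Longrightarrow> x \<noteq> 0 \<Longrightarrow> to_fract (D x) = to_fract x * log_deriv x"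
  using log_deriv_eq[of x 1] by simp

text \<open>The exponent \<open>m * n\<close> brings powers of both factors and of the product into
  \<open>A\<close>, where the product rule for \<open>D\<close> applies.\<close>

lemma log_deriv_mult:
  assumes "x \<in> B i" "y \<in> B j" "x \<noteq> 0" "y \<noteq> 0"
  shows "log_deriv (x * y) = log_deriv x + log_deriv y"
proof -
  obtain m n where m: "m > 0" "x ^ m \<in> A" and n: "n > 0" "y ^ n \<in> A" using ex_power_A assms by meson
  let ?k = "m * n"
  have x: "x ^ ?k \<in> A" and y: "y ^ ?k \<in> A"
    using power_mem_subring[OF m(2), of n] power_mem_subring[OF n(2), of m]
    by (simp_all add: power_mult[symmetric] mult.commute)
  have k: "?k > 0" using m n by simp
  have xy: "(x * y) ^ ?k \<in> A" using subring_mem(4)[OF x y] by (simp add: power_mult_distrib)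
  have "D ((x * y) ^ ?k) = D (x ^ ?k) * y ^ ?k + x ^ ?k * D (y ^ ?k)"
    using D_mult[OF x y] by (simp add: power_mult_distrib)
  then have "to_fract (D ((x * y) ^ ?k)) =
      to_fract (D (x ^ ?k)) * to_fract (y ^ ?k) + to_fract (x ^ ?k) * to_fract (D (y ^ ?k))"
    by (metis to_fract_add to_fract_mult)
  moreover have "to_fract (of_nat ?k :: 'b) \<noteq> 0" "to_fract (x ^ ?k) \<noteq> 0" "to_fract (y ^ ?k) \<noteq> 0"
    using assms char_0[OF k] by (simp_all del: of_nat_mult)
  moreover have "(p * z + y * q) / (k * (y * z)) = p / (k * y) + q / (k * z)"
    if "k \<noteq> 0" "y \<noteq> 0" "z \<noteq> 0" for p q k y z :: "'b fract"
    using that by (simp add: field_simps)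
  ultimately have "to_fract (D ((x * y) ^ ?k)) / to_fract (of_nat ?k * (x * y) ^ ?k) =
      to_fract (D (x ^ ?k)) / to_fract (of_nat ?k * x ^ ?k) +
      to_fract (D (y ^ ?k)) / to_fract (of_nat ?k * y ^ ?k)"
    by (simp only: power_mult_distrib to_fract_mult not_False_eq_True)
  then show ?thesis
    using log_deriv_eq[OF _ k xy] log_deriv_eq[OF _ k x] log_deriv_eq[OF _ k y] assms(3,4) by simp
qed

text \<open>Saturation enters here: the degrees of homogeneous elements outside \<open>P\<close>
  form a monoid, since \<open>P\<close> is prime, and the group it generates contains
  \<open>i\<close>. Being torsion modulo \<open>H\<close>, the monoid contains the negative of
  \<open>i\<close> modulo \<open>H\<close>.\<close>

lemma homogeneous_complement:
  assumes P: "P \<in> Spec1" and x: "x \<in> B i" "x \<noteq> 0"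
  obtains j u where "u \<in> B j" "u \<notin> P" "i + j \<in> H"
proof -
  have prime: "is_prime_ideal P" using P by (simp add: Spec1_def)
  obtain j where "j \<in> MM B P" "i + j \<in> H"
  proof (rule monoid_meets_coset[of "MM B P" H i])
    show "0 \<in> MM B P" using one_mem is_prime_idealD(2)[OF prime] by (auto simp: MM_def)
    show "a + b \<in> MM B P" if ab: "a \<in> MM B P" "b \<in> MM B P" for a b
    proof -
      obtain u v where "u \<in> B a" "v \<in> B b" "u \<notin> P" "v \<notin> P" using ab by (auto simp: MM_def)
      then have "u * v \<in> B (a + b)" "u * v \<notin> P" using mult_mem is_prime_idealD(3)[OF prime] by blast+
      then show ?thesis by (auto simp: MM_def)
    qed
    show "\<exists>n>0. nmult n a \<in> H" if a: "a \<in> MM B P" for a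
    proof -
      obtain u where "u \<in> B a" "u \<notin> P" using a by (auto simp: MM_def)
      then show ?thesis using torsion is_idealD(1)[OF is_prime_idealD(1)[OF prime]] by metis
    qed
  qed (use H unit_degrees[OF P x] in auto)
  then show thesis using that by (auto simp: MM_def)
qed

text \<open>At a height one prime \<open>P\<close>, the element \<open>u\<close> from
  \<open>homogeneous_complement\<close> rewrites the left side as
  \<open>D (x * u) / u - x * log_deriv u\<close>, whose denominators \<open>u\<close> and
  \<open>m u^m\<close> avoid \<open>P\<close>. Being regular at every such prime, it lies in the
  ring.\<close>

lemma log_deriv_integral:
  assumes x: "x \<in> B i" "x \<noteq> 0"
  shows "to_fract x * log_deriv x \<in> range to_fract"
proof -
  obtain n where n: "n > 0" "x ^ n \<in> A" using ex_power_A[OF x(1)] by blast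
  let ?a = "x * D (x ^ n)" and ?b = "of_nat n * x ^ n"
  have b0: "?b \<noteq> 0" using n x by (simp add: char_0)
  have eq: "to_fract x * log_deriv x = to_fract ?a / to_fract ?b"
    using log_deriv_eq[OF x(2) n] by simp
  have "?b dvd ?a"
  proof (rule dvd_if_locally_dvd_in_height_one[OF noetherian normal b0])
    fix P :: "'b set" assume P: "P \<in> Spec1"
    then have prime: "is_prime_ideal P" by (simp add: Spec1_def)
    obtain j u where u: "u \<in> B j" "u \<notin> P" "i + j \<in> H" using homogeneous_complement[OF P x] .
    have u0: "u \<noteq> 0" using u(2) is_idealD(1)[OF is_prime_idealD(1)[OF prime]] by metis
    obtain m where m: "m > 0" "u ^ m \<in> A" using ex_power_A[OF u(1)] by blast
    obtain v where v: "of_nat m * v = (1::'b)" using rational m(1) by (auto simp: rational_ring_def)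
    have m': "of_nat m \<notin> P"
      using is_idealD(5)[OF is_prime_idealD(1)[OF prime], of "of_nat m" v] v is_prime_idealD(2)[OF prime] by auto
    have xuA: "x * u \<in> A" using component_A[OF u(3) mult_mem[OF x(1) u(1)]] .
    \<comment> \<open>\<open>?w\<close> is a common denominator of \<open>D (x * u) / u\<close> and
      \<open>x D(u^m) / (m u^m)\<close>, being \<open>m u^(m-1)\<close> times \<open>u\<close>;
      \<open>?c\<close> is the numerator of their difference.\<close>
    let ?w = "of_nat m * u ^ m" and ?c = "of_nat m * u ^ (m - 1) * D (x * u) - x * D (u ^ m)"
    have "to_fract (D (x * u)) = to_fract (x * u) * (log_deriv x + log_deriv u)"
      using log_deriv_A[OF xuA] log_deriv_mult[OF x(1) u(1) x(2) u0] x(2) u0 by simp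
    then have "to_fract x * log_deriv x = to_fract (D (x * u)) / to_fract u - to_fract x * log_deriv u"
      using u0 by (simp add: field_simps)
    then have "to_fract ?a / to_fract ?b = to_fract (D (x * u)) / to_fract u - to_fract x * (to_fract (D (u ^ m)) / to_fract ?w)"
      using log_deriv_eq[OF u0 m] eq by simp
    moreover have "to_fract ?w = to_fract (of_nat m * u ^ (m - 1)) * to_fract u"
      using m(1) by (cases m) simp_all
    moreover have w0: "to_fract ?w \<noteq> 0" using m u0 by (simp add: char_0 del: to_fract_mult)
    moreover have "p / y - z * (q / w) = (v * p - z * q) / w" if "w = v * y" "w \<noteq> 0" for p y z q v w :: "'b fract"
      using that by (auto simp: field_simps)
    ultimately have "to_fract ?a / to_fract ?b = to_fract ?c / to_fract ?w"
      by (simp only: to_fract_diff to_fract_mult)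
    then have "to_fract (?w * ?a) = to_fract (?b * ?c)"
      using w0 b0 by (simp add: frac_eq_eq ac_simps del: of_nat_mult)
    then have "?w * ?a = ?b * ?c" by (simp only: to_fract_eq_iff)
    moreover have "?w \<notin> P" using is_prime_idealD(3,4)[OF prime] m' u(2) by blast
    ultimately show "\<exists>w. w \<notin> P \<and> ?b dvd w * ?a" by (intro exI[of _ ?w]) simp
  qed
  then obtain c where "?a = ?b * c" by (elim dvdE)
  then have "to_fract ?a = to_fract ?b * to_fract c" by (metis to_fract_mult)
  moreover have "to_fract ?b \<noteq> 0" using b0 by (simp only: to_fract_eq_0_iff not_False_eq_True)
  ultimately have "to_fract ?a / to_fract ?b = to_fract c" by (metis nonzero_mult_div_cancel_left)
  then show ?thesis unfolding eq by blast
qed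

text \<open>Only values at homogeneous elements matter: there \<open>log_deriv_integral\<close>
  guarantees that the product lies in the ring.\<close>

definition ext :: "'b \<Rightarrow> 'b" where
  "ext x = (SOME y. to_fract y = to_fract x * log_deriv x)"

lemma to_fract_ext: "x \<in> B i \<Longrightarrow> to_fract (ext x) = to_fract x * log_deriv x"
  unfolding ext_def by (rule someI_ex) (use log_deriv_integral[of x i] in \<open>cases "x = 0"\<close>, auto)

lemma ext_A: "i \<in> H \<Longrightarrow> x \<in> B i \<Longrightarrow> ext x = D x"
proof (cases "x = 0")
  case False
  assume "i \<in> H" "x \<in> B i"
  then have "to_fract (ext x) = to_fract (D x)"
    using to_fract_ext log_deriv_A[OF component_A False] by simp
  then show ?thesis by (simp only: to_fract_eq_iff)
qed (use to_fract_ext[of 0 i] in simp)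

lemma ext_mult:
  assumes "x \<in> B i" "y \<in> B j"
  shows "ext (x * y) = ext x * y + x * ext y"
proof (cases "x = 0 \<or> y = 0")
  case True
  have "ext 0 = 0" using to_fract_ext[of 0 0] component_mem(1) by simp
  then show ?thesis using True by auto
next
  case False
  then have "to_fract (ext (x * y)) = to_fract (ext x * y + x * ext y)"
    using to_fract_ext[OF assms(1)] to_fract_ext[OF assms(2)] to_fract_ext[OF mult_mem[OF assms]]
      log_deriv_mult[OF assms] by (simp add: algebra_simps)
  then show ?thesis by (simp only: to_fract_eq_iff)
qed

text \<open>Additivity is not visible from the logarithmic derivative. Multiplication by
  \<open>z = x^(n-1)\<close> moves \<open>x\<close>, \<open>y\<close> and their sum into
  \<open>A\<close>, where \<open>D\<close> is additive; the product rule then allows cancelling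
  \<open>z\<close>.\<close>

lemma ext_add:
  assumes "x \<in> B i" "y \<in> B i"
  shows "ext (x + y) = ext x + ext y"
proof (cases "x = 0")
  case True
  have "ext 0 = 0" using to_fract_ext[of 0 0] component_mem(1) by simp
  then show ?thesis using True by auto
next
  case False
  obtain n where n: "n > 0" "nmult n i \<in> H" using torsion[OF assms(1) False] by blast
  then obtain m where m: "n = Suc m" by (cases n) auto
  define z where "z = x ^ m"
  have z: "z \<in> B (nmult m i)" "z \<noteq> 0" using power_mem[OF assms(1)] False by (auto simp: z_def)
  have zw: "z * w \<in> B (nmult n i)" if "w \<in> B i" for w
    using mult_mem[OF z(1) that] m by (simp add: add.commute)
  have D: "D (z * w) = ext z * w + z * ext w" if "w \<in> B i" for w
    using ext_A[OF n(2) zw[OF that]] ext_mult[OF z(1) that] by simp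
  have "D (z * x + z * y) = D (z * x) + D (z * y)"
    using D_add[OF component_A[OF n(2) zw] component_A[OF n(2) zw]] assms by blast
  then have "z * ext (x + y) = z * (ext x + ext y)"
    using D[OF assms(1)] D[OF assms(2)] D[OF component_mem(2)[OF assms]] by (simp add: algebra_simps)
  then show ?thesis using z(2) by simp
qed

text \<open>The identity \<open>n x^(n-1) ext x = D (x^n)\<close> has a homogeneous right side, and
  the homogeneous factor \<open>n x^(n-1)\<close> cancels.\<close>

lemma ext_degree:
  assumes x: "x \<in> B i"
  shows "ext x \<in> B (i + d)"
proof (cases "x = 0")
  case True
  then show ?thesis using to_fract_ext[OF x] component_mem(1) by simp
next
  case False
  obtain n where n: "n > 0" "nmult n i \<in> H" using torsion[OF x False] by blast
  then obtain m where m: "n = Suc m" by (cases n) auto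
  have "to_fract (D (x ^ n)) = to_fract (of_nat n * x ^ m * ext x)"
    using log_deriv_eq[OF False n(1) power_A[OF n(2) x]] to_fract_ext[OF x] char_0[OF n(1)] False m
    by (simp add: field_simps del: of_nat_Suc)
  then have eq: "of_nat n * x ^ m * ext x = D (x ^ n)" by (simp only: to_fract_eq_iff)
  show ?thesis
  proof (rule cancel_homogeneous[of "of_nat n * x ^ m" "nmult m i"])
    show "of_nat n * x ^ m \<in> B (nmult m i)" by (rule of_nat_mult_mem[OF power_mem[OF x]])
    show "of_nat n * x ^ m * ext x \<in> B (nmult m i + (i + d))"
      using degree[OF n(2) power_mem[OF x]] m unfolding eq by (simp add: ac_simps)
    show "y = 0" if "of_nat n * x ^ m * y = 0" for y
      using that char_0[OF n(1)] False by simp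
  qed
qed

text \<open>With \<open>F = x\<^sup>n\<close> and \<open>G = (ext x)\<^sup>n\<close> one has \<open>(D F)\<^sup>n = n\<^sup>n F\<^sup>n\<^sup>-\<^sup>1 G\<close>, so \<open>G\<close> has degree
  \<open>deg F - n\<close> unless it vanishes.\<close>

lemma ext_nilpotent:
  assumes "n > 0" "nmult n i \<in> H" "x \<in> B i"
  shows "\<exists>k. (ext ^^ k) x = 0"
  using assms(2,3)
proof (induction "deg (x ^ n)" arbitrary: x i rule: less_induct)
  case less
  note iH = less.prems(1) and x = less.prems(2)
  obtain m where m: "n = Suc m" using assms(1) by (cases n) auto
  let ?F = "x ^ n" and ?y = "ext x"
  have y: "?y \<in> B (i + d)" by (rule ext_degree[OF x])
  \<comment> \<open>Since \<open>d\<close> lies in \<open>H\<close>, the same exponent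
    \<open>n\<close> serves for \<open>ext x\<close>, so it stays fixed during the
    induction.\<close>
  have idH: "nmult n (i + d) \<in> H"
    using is_subgroupD(2)[OF H iH nmult_mem[OF H d]] by (simp add: nmult_add)
  have FA: "?F \<in> A" and GA: "?y ^ n \<in> A" using power_A[OF iH x] power_A[OF idH y] by auto
  show ?case
  proof (cases "x = 0 \<or> ?y = 0")
    case True
    then show ?thesis using exI[of "\<lambda>k. (ext ^^ k) x = 0" 0] exI[of "\<lambda>k. (ext ^^ k) x = 0" "Suc 0"] by auto
  next
    case False
    then have x0: "x \<noteq> 0" and y0: "?y \<noteq> 0" by auto
    have "to_fract (D ?F) = to_fract (of_nat n * x ^ m * ?y)"
      using log_deriv_eq[OF x0 assms(1) FA] to_fract_ext[OF x] char_0[OF assms(1)] x0 m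
      by (simp add: field_simps del: of_nat_Suc)
    then have DF: "D ?F = of_nat n * x ^ m * ?y" by (simp only: to_fract_eq_iff)
    then have DF0: "D ?F \<noteq> 0" using x0 y0 char_0[OF assms(1)] by simp
    have F0: "?F \<noteq> 0" and G0: "?y ^ n \<noteq> 0" using x0 y0 by auto
    have "(D ?F) ^ n = of_nat (n ^ n) * (?F ^ m * ?y ^ n)"
      unfolding DF by (simp add: power_mult_distrib power_mult[symmetric] mult.commute[of n m] ac_simps)
    then have "deg ((D ?F) ^ n) = deg (of_nat (n ^ n) * (?F ^ m * ?y ^ n))" by simp
    moreover have "of_nat (n ^ n) \<noteq> (0::'b)" by (rule char_0) (use assms(1) in simp)
    ultimately have "n * deg (D ?F) = m * deg ?F + deg (?y ^ n)"
      using FA GA F0 G0 DF0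
      by (simp add: deg_power deg_mult D_mem power_mem_subring subring_mem of_nat_mem_subring
          deg_kernel[OF D_of_nat] del: of_nat_power)
    then have "deg (?y ^ n) < deg ?F"
      using deg_D[OF FA DF0] m by (simp add: algebra_simps)
    then obtain k where "(ext ^^ k) ?y = 0" using less.hyps[OF _ idH y] by blast
    then have "(ext ^^ Suc k) x = 0" by (simp add: funpow_swap1)
    then show ?thesis by blast
  qed
qed

definition extension :: "'b \<Rightarrow> 'b" where
  "extension = extend_homogeneous ext"

lemma extension_homogeneous: "x \<in> B i \<Longrightarrow> extension x = ext x"
  unfolding extension_def by (rule extend_homogeneous_homogeneous) (rule ext_add)

lemma extension_derivation: "is_derivation UNIV extension"
  unfolding extension_def by (rule extend_homogeneous_derivation) (rule ext_add ext_mult; assumption)+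

lemma extension_degree: "x \<in> B i \<Longrightarrow> extension x \<in> B (i + d)"
  using extension_homogeneous ext_degree by metis

lemma extension_locally_nilpotent: "locally_nilpotent UNIV extension"
proof (rule locally_nilpotent_UNIV_if_homogeneous[OF extension_derivation])
  fix i x assume x: "x \<in> B i"
  have eq: "(extension ^^ k) y = (ext ^^ k) y" if "y \<in> B j" for k y j
    using that
  proof (induction k arbitrary: y j)
    case (Suc k)
    then show ?case using extension_homogeneous[OF Suc.prems] Suc.IH[OF ext_degree[OF Suc.prems]]
      by (simp add: funpow_Suc_right del: funpow.simps)
  qed simp
  show "\<exists>n. (extension ^^ n) x = 0"
  proof (cases "x = 0")
    case True
    then show ?thesis by (intro exI[of _ 0]) simp
  next
    case False
    then show ?thesis using torsion[OF x] ext_nilpotent[OF _ _ x] eq[OF x] by metis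
  qed
qed

lemma extension_nonzero:
  assumes "D x \<noteq> 0"
  shows "\<exists>y. extension y \<noteq> 0"
proof (rule ccontr)
  assume "\<not> ?thesis"
  then have 0: "D y = 0" if "i \<in> H" "y \<in> B i" for y i
    using that ext_A extension_homogeneous by metis
  have "x \<in> A" using assms D_outside by blast
  then have "D x = 0" by (induction rule: subring_of_degrees_induct) (auto simp: D_add 0)
  with assms show False by simp
qed

end

section \<open>Local slices and height one primes\<close>

lemma group_closure_subset:
  assumes "S \<subseteq> group_closure T"
  shows "group_closure S \<subseteq> group_closure T"
proof
  fix x assume "x \<in> group_closure S"
  then show "x \<in> group_closure T"
    by (induction rule: group_closure.induct) (use assms in \<open>auto intro: group_closure.diff\<close>)
qed

locale graded_lnd = graded_ring B + lnd_on UNIV D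
  for B :: "'g::ab_group_add \<Rightarrow> 'b::idom set" and D :: "'b \<Rightarrow> 'b" +
  fixes d :: 'g
  assumes degree: "\<And>i x. x \<in> B i \<Longrightarrow> D x \<in> B (i + d)"
    and rational: "rational_ring TYPE('b)"
    and nonzero: "\<exists>x. D x \<noteq> 0"
begin

lemma ex_homogeneous_nonzero: "\<exists>i. \<exists>x\<in>B i. D x \<noteq> 0"
proof (rule ccontr)
  assume "\<not> ?thesis"
  then have "D x = 0" for x
    by (induction x rule: homogeneous_induct) (auto simp: D_add)
  then show False using nonzero by blast
qed

lemma hcomp_D: "hcomp B (D x) (i + d) = D (hcomp B x i)"
proof (induction x rule: homogeneous_induct)
  case (homogeneous x j)
  then show ?case using hcomp_homogeneous[OF homogeneous] hcomp_homogeneous[OF degree[OF homogeneous]] by simp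
qed (auto simp: D_add hcomp_add)

lemma hcomp_kernel: "D x = 0 \<Longrightarrow> D (hcomp B x i) = 0"
  using hcomp_D[of x i] by simp

definition kernel_degrees :: "'g set" where
  "kernel_degrees = {j. \<exists>k\<in>B j. k \<noteq> 0 \<and> D k = 0}"

text \<open>Take a homogeneous \<open>x\<close> outside the kernel and apply \<open>D\<close> one
  time less than its degree.\<close>

lemma ex_local_slice:
  obtains s i where "s \<in> B i" "D s \<noteq> 0" "D (D s) = 0"
proof -
  obtain i x where x: "x \<in> B i" "D x \<noteq> 0" using ex_homogeneous_nonzero by blast
  then obtain m where m: "deg x = Suc m" using deg_D[of x] by auto
  have "x \<noteq> 0" using x by auto
  then have "(D ^^ Suc m) x \<noteq> 0" "(D ^^ Suc (Suc m)) x = 0" using deg_props[of x] m by auto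
  moreover have "\<exists>j. (D ^^ m) x \<in> B j" by (induction m) (use x degree in auto)
  ultimately show thesis using that by auto
qed

end

text \<open>For a local slice \<open>s\<close> with \<open>t = D s\<close>, localization gives \<open>B\<^sub>t = K\<^sub>t[s]\<close> where \<open>K\<close> is the kernel
  of \<open>D\<close>; the ideal below is the contraction of the prime \<open>s K\<^sub>t[s]\<close>.\<close>

locale graded_lnd_slice = graded_lnd B D d
  for B :: "'g::ab_group_add \<Rightarrow> 'b::idom set" and D :: "'b \<Rightarrow> 'b" and d :: 'g +
  fixes s :: 'b and i\<^sub>s :: 'g
  assumes s: "s \<in> B i\<^sub>s" "D s \<noteq> 0" "D (D s) = 0"
begin

abbreviation "t \<equiv> D s"

definition slice_ideal :: "'b set" where
  "slice_ideal = {b. \<exists>m c. t ^ m * b = s * c}"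

lemma s_neq_0: "s \<noteq> 0"
  using s(2) by auto

lemma D_t_power: "D (t ^ m) = 0"
  using D_power[of t m] s by simp

lemma deg_kernel_mult: "D k = 0 \<Longrightarrow> k \<noteq> 0 \<Longrightarrow> x \<noteq> 0 \<Longrightarrow> deg (k * x) = deg x"
  by (simp add: deg_mult deg_kernel)

lemma deg_s_mult: "x \<noteq> 0 \<Longrightarrow> deg (s * x) = Suc (deg x)"
  using deg_D[of s] s deg_kernel[of t] by (simp add: deg_mult s_neq_0)

text \<open>For nonzero \<open>k\<close>, the element \<open>t^m k\<close> has degree 0, whereas a
  nonzero multiple of \<open>s\<close> has positive degree.\<close>

lemma kernel_slice_ideal:
  assumes "D k = 0" "k \<in> slice_ideal"
  shows "k = 0"
proof (rule ccontr)
  assume "k \<noteq> 0"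
  obtain m c where mc: "t ^ m * k = s * c" using assms(2) by (auto simp: slice_ideal_def)
  have "t ^ m * k \<noteq> 0" using \<open>k \<noteq> 0\<close> s(2) by simp
  then have "c \<noteq> 0" using mc by auto
  have "D (t ^ m * k) = 0" using assms(1) by (simp add: D_mult D_t_power)
  then have "deg (s * c) = 0" using deg_kernel mc by metis
  then show False using deg_s_mult[OF \<open>c \<noteq> 0\<close>] by simp
qed

lemma D_slice_power: "D (s ^ Suc n) = of_nat (Suc n) * t * s ^ n"
proof -
  have "D (s ^ Suc n) * s = of_nat (Suc n) * t * s ^ n * s"
    using D_power[of s "Suc n"] by (simp add: ac_simps del: of_nat_Suc)
  then show ?thesis using s_neq_0 by (metis mult_right_cancel)
qed

text \<open>Needed to cancel the leading term in the expansion of an element in powers of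
  \<open>s\<close>.\<close>

lemma funpow_slice_power: "(D ^^ n) (s ^ n) = of_nat (fact n) * t ^ n"
proof (induction n)
  case (Suc n)
  have Dz: "D (of_nat (Suc n) * t) = 0" using s(3) D_of_nat[of "Suc n"] by (simp add: D_mult del: of_nat_Suc)
  have "(D ^^ Suc n) (s ^ Suc n) = (D ^^ n) (of_nat (Suc n) * t * s ^ n)"
    by (simp only: funpow_Suc_right o_apply D_slice_power)
  also have "\<dots> = of_nat (Suc n) * t * (D ^^ n) (s ^ n)"
    by (rule funpow_kernel_mult[OF UNIV_I Dz UNIV_I])
  finally show ?case unfolding Suc by (simp add: ac_simps distrib_left distrib_right)
qed simp

text \<open>This is \<open>B_t = K_t[s]\<close> read modulo \<open>s\<close>. With \<open>N\<close>
  the degree bound and \<open>a = D^N b\<close> in the kernel, \<open>N! t^N b - a s^N\<close> is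
  killed by \<open>D^N\<close>, which drives the induction; the subtracted term is a multiple of
  \<open>s\<close>.\<close>

lemma ex_kernel_mod_slice: "\<exists>m k c. D k = 0 \<and> t ^ m * b = k + s * c"
proof -
  have "\<exists>m k c. D k = 0 \<and> t ^ m * b = k + s * c" if "(D ^^ Suc n) b = 0" for n
    using that
  proof (induction n arbitrary: b)
    case 0
    then show ?case by (intro exI[of _ 0] exI[of _ b]) auto
  next
    case (Suc n)
    let ?N = "Suc n"
    let ?f = "of_nat (fact ?N) :: 'b"
    define a where "a = (D ^^ ?N) b"
    have Da: "D a = 0" using Suc.prems by (simp add: a_def)
    define b' where "b' = ?f * t ^ ?N * b - a * s ^ ?N"
    have Df: "D (?f * t ^ ?N) = 0"
      using D_t_power[of ?N] D_of_nat[of "fact ?N"] by (simp only: D_mult UNIV_I mult_zero_left mult_zero_right add_0)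
    have "(D ^^ ?N) b' + a * (?f * t ^ ?N) = (D ^^ ?N) b' + (D ^^ ?N) (a * s ^ ?N)"
      unfolding funpow_kernel_mult[OF UNIV_I Da UNIV_I] funpow_slice_power ..
    also have "\<dots> = (D ^^ ?N) (?f * t ^ ?N * b)"
      unfolding funpow_add[OF UNIV_I UNIV_I, symmetric] b'_def diff_add_cancel ..
    also have "\<dots> = ?f * t ^ ?N * a"
      unfolding funpow_kernel_mult[OF UNIV_I Df UNIV_I] a_def ..
    finally have "(D ^^ ?N) b' = 0" by (simp add: mult.commute)
    then obtain m k c where IH: "D k = 0" "t ^ m * b' = k + s * c" using Suc.IH by blast
    \<comment> \<open>The inverse \<open>v\<close> of the factorial is itself in the kernel, since
      \<open>?f * D v = D 1 = 0\<close>; so \<open>v * k\<close> remains there.\<close>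
    obtain v where v: "?f * v = 1" using rational unfolding rational_ring_def by (metis fact_gt_zero)
    have "?f * D v = D (?f * v)" using D_of_nat[of "fact ?N"] by (simp only: D_mult UNIV_I mult_zero_left add_0)
    then have "?f * D v = 0" using v by simp
    moreover have "?f \<noteq> 0" by (rule char_0) simp
    ultimately have Dv: "D v = 0" by simp
    have "t ^ (m + ?N) * b = v * (t ^ m * (?f * t ^ ?N * b))"
      using v by (simp add: power_add) (metis (no_types, lifting) mult.assoc mult.commute mult_1)
    also have "\<dots> = v * (t ^ m * b' + t ^ m * (a * s ^ ?N))"
      unfolding b'_def by (simp only: distrib_left[symmetric] diff_add_cancel)
    also have "\<dots> = v * k + s * (v * (c + t ^ m * a * s ^ n))"
      unfolding IH(2) by (simp add: algebra_simps)
    finally have "t ^ (m + ?N) * b = v * k + s * (v * (c + t ^ m * a * s ^ n))" .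
    moreover have "D (v * k) = 0" using Dv IH(1) by (simp add: D_mult)
    ultimately show ?case by blast
  qed
  then show ?thesis using deg_props(1)[of b] by blast
qed

text \<open>Up to powers of \<open>t\<close>, every element is congruent to a kernel element modulo
  \<open>s\<close>. The kernel is a domain that meets the ideal only in zero.\<close>

lemma slice_ideal_prime: "is_prime_ideal slice_ideal"
  unfolding is_prime_ideal_def
proof (intro conjI allI impI)
  show id: "is_ideal slice_ideal"
    unfolding is_ideal_def is_subgroup_def
  proof (intro conjI ballI allI)
    show "0 \<in> slice_ideal" by (auto simp: slice_ideal_def intro: exI[of _ 0])
    fix x y r assume "x \<in> slice_ideal"
    then obtain m c where x: "t ^ m * x = s * c" by (auto simp: slice_ideal_def)
    then have "t ^ m * (- x) = s * (- c)" by simp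
    then show "- x \<in> slice_ideal" unfolding slice_ideal_def by blast
    have "t ^ m * (r * x) = s * (r * c)" using x by (simp add: mult.left_commute)
    then show "r * x \<in> slice_ideal" unfolding slice_ideal_def by blast
    assume "y \<in> slice_ideal"
    then obtain m' c' where y: "t ^ m' * y = s * c'" by (auto simp: slice_ideal_def)
    have "t ^ (m + m') * (x + y) = t ^ m' * (t ^ m * x) + t ^ m * (t ^ m' * y)"
      by (simp add: power_add algebra_simps)
    also have "\<dots> = s * (t ^ m' * c + t ^ m * c')" unfolding x y by (simp add: algebra_simps)
    finally show "x + y \<in> slice_ideal" unfolding slice_ideal_def by blast
  qed
  have "1 \<notin> slice_ideal" using kernel_slice_ideal[of 1] by auto
  then show "slice_ideal \<noteq> UNIV" by blast
  fix x y assume xy: "x * y \<in> slice_ideal"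
  obtain m k c where x: "D k = 0" "t ^ m * x = k + s * c" using ex_kernel_mod_slice by blast
  obtain m' k' c' where y: "D k' = 0" "t ^ m' * y = k' + s * c'" using ex_kernel_mod_slice by blast
  have s_mult: "s * a \<in> slice_ideal" for a
    unfolding slice_ideal_def by (intro CollectI exI[of _ 0] exI[of _ a]) simp
  have "k * k' = t ^ m * t ^ m' * (x * y) + s * (s * c * c' - c * (k' + s * c') - c' * (k + s * c))"
  proof -
    have "t ^ m * t ^ m' * (x * y) = (k + s * c) * (k' + s * c')"
      using x(2) y(2) by (metis mult.assoc mult.left_commute)
    then show ?thesis by (simp add: algebra_simps)
  qed
  then have "k * k' \<in> slice_ideal" using is_idealD(2,4)[OF id] xy s_mult by metis
  moreover have "D (k * k') = 0" using x(1) y(1) by (simp add: D_mult)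
  ultimately have "k = 0 \<or> k' = 0" using kernel_slice_ideal by force
  then show "x \<in> slice_ideal \<or> y \<in> slice_ideal"
    using x(2) y(2) by (auto simp: slice_ideal_def)
qed

text \<open>A nonzero \<open>f\<close> in a prime \<open>Q\<close> inside the ideal satisfies
  \<open>t^m f = s c\<close>, so \<open>Q\<close> contains \<open>s\<close> or the element
  \<open>c\<close> of smaller degree; by descent it contains \<open>s\<close>. As powers of
  \<open>t\<close> avoid \<open>Q\<close>, the whole ideal follows.\<close>

lemma slice_ideal_Spec1: "slice_ideal \<in> Spec1"
proof (rule Spec1_minimal_nonzero[OF slice_ideal_prime])
  have sP: "s \<in> slice_ideal"
    unfolding slice_ideal_def by (intro CollectI exI[of _ 0] exI[of _ 1]) simp
  then show "slice_ideal \<noteq> {0}" using s_neq_0 by blast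
  fix Q assume Q: "is_prime_ideal Q" "Q \<noteq> {0}" "Q \<subseteq> slice_ideal"
  note Qi = is_idealD[OF is_prime_idealD(1)[OF Q(1)]]
  have "s \<in> Q" if "f \<in> Q" "f \<noteq> 0" for f
    using that
  proof (induction "deg f" arbitrary: f rule: less_induct)
    case less
    then obtain m c where mc: "t ^ m * f = s * c" using Q(3) by (auto simp: slice_ideal_def)
    have "t ^ m * f \<noteq> 0" using less.prems s(2) by simp
    then have c0: "c \<noteq> 0" using mc by auto
    have "deg f = Suc (deg c)"
      using deg_kernel_mult[OF D_t_power _ less.prems(2), of m] deg_s_mult[OF c0] mc s(2) by simp
    moreover have "s * c \<in> Q" unfolding mc[symmetric] by (rule Qi(4)[OF less.prems(1)])
    then have "s \<in> Q \<or> c \<in> Q" by (rule is_prime_idealD(3)[OF Q(1)])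
    ultimately show ?case using less.hyps[of c] c0 by auto
  qed
  moreover obtain f where "f \<in> Q" "f \<noteq> 0" using Q(2) Qi(1) by blast
  ultimately have sQ: "s \<in> Q" by blast
  have "t \<notin> slice_ideal" using kernel_slice_ideal[of t] s by blast
  then have tQ: "t ^ m \<notin> Q" for m using is_prime_idealD(4)[OF Q(1)] Q(3) by blast
  have "b \<in> Q" if b: "b \<in> slice_ideal" for b
  proof -
    obtain m c where "t ^ m * b = s * c" using b by (auto simp: slice_ideal_def)
    then have "t ^ m * b \<in> Q" using Qi(5)[OF sQ] by simp
    then show ?thesis using tQ is_prime_idealD(3)[OF Q(1)] by blast
  qed
  then show "Q = slice_ideal" using Q(3) by blast
qed

text \<open>For homogeneous \<open>u\<close> outside the ideal write \<open>t^m u = k + s c\<close>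
  with \<open>k\<close> in the kernel. The component of \<open>k\<close> in the degree of
  \<open>t^m u\<close> is nonzero, as otherwise \<open>s\<close> would divide \<open>t^m u\<close>.
  So the degree of \<open>u\<close> is a difference of kernel degrees.\<close>

lemma MM_slice_ideal: "MM B slice_ideal \<subseteq> group_closure kernel_degrees"
proof
  fix i assume "i \<in> MM B slice_ideal"
  then obtain u where u: "u \<in> B i" "u \<notin> slice_ideal" by (auto simp: MM_def)
  obtain m k c where k: "D k = 0" "t ^ m * u = k + s * c" using ex_kernel_mod_slice by blast
  have tm: "t ^ m \<in> B (nmult m (i\<^sub>s + d))" by (rule power_mem[OF degree[OF s(1)]])
  let ?l = "nmult m (i\<^sub>s + d) + i"
  have "t ^ m * u = hcomp B (t ^ m * u) ?l" using hcomp_homogeneous[OF mult_mem[OF tm u(1)]] by simp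
  also have "\<dots> = hcomp B k ?l + s * hcomp B c (?l - i\<^sub>s)"
    using hcomp_mult[OF s(1), of c "?l - i\<^sub>s"] unfolding k(2) by (simp add: hcomp_add)
  finally have "hcomp B k ?l \<noteq> 0" using u(2) unfolding slice_ideal_def by force
  then have "?l \<in> kernel_degrees"
    unfolding kernel_degrees_def using hcomp_props(1) hcomp_kernel[OF k(1)] by blast
  moreover have "nmult m (i\<^sub>s + d) \<in> kernel_degrees"
    unfolding kernel_degrees_def using tm D_t_power s(2) by (intro CollectI bexI[of _ "t ^ m"]) auto
  ultimately have "?l - nmult m (i\<^sub>s + d) \<in> group_closure kernel_degrees"
    by (intro group_closure.diff group_closure.base) auto
  then show "i \<in> group_closure kernel_degrees" by simp
qed

end

section \<open>Restricting a derivation of the whole ring to the degrees in a subgroup\<close>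

context graded_lnd
begin

context
  fixes H :: "'g set"
  assumes H: "is_subgroup H"
    and torsion: "\<And>i x. x \<in> B i \<Longrightarrow> x \<noteq> 0 \<Longrightarrow> \<exists>n>0. nmult n i \<in> H"
    and unit_degrees: "\<And>P i x. P \<in> Spec1 \<Longrightarrow> x \<in> B i \<Longrightarrow> x \<noteq> 0 \<Longrightarrow> i \<in> group_closure (MM B P)"
begin

text \<open>Saturation at the prime \<open>slice_ideal\<close> puts the degrees of \<open>s\<close>
  and \<open>D s\<close> in the group generated by \<open>kernel_degrees\<close>; their difference
  is \<open>d\<close>. The kernel degrees form a monoid that is torsion modulo \<open>H\<close>, so
  some \<open>j\<close> cancels \<open>d\<close> there.\<close>

lemma ex_kernel_multiplier:
  obtains k j where "k \<in> B j" "k \<noteq> 0" "D k = 0" "d + j \<in> H"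
proof -
  obtain s i\<^sub>s where s: "s \<in> B i\<^sub>s" "D s \<noteq> 0" "D (D s) = 0" using ex_local_slice .
  interpret graded_lnd_slice B D d s i\<^sub>s by unfold_locales (use s in auto)
  have "group_closure (MM B slice_ideal) \<subseteq> group_closure kernel_degrees"
    by (rule group_closure_subset[OF MM_slice_ideal])
  then have mem: "i \<in> group_closure kernel_degrees" if "x \<in> B i" "x \<noteq> 0" for x i
    using unit_degrees[OF slice_ideal_Spec1] that by blast
  have "(i\<^sub>s + d) - i\<^sub>s \<in> group_closure kernel_degrees"
    by (intro group_closure.diff mem[OF s(1) s_neq_0] mem[OF degree[OF s(1)] s(2)])
  then have dmem: "d \<in> group_closure kernel_degrees" by simp
  obtain j where "j \<in> kernel_degrees" "d + j \<in> H"
  proof (rule monoid_meets_coset[of kernel_degrees H d])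
    show "0 \<in> kernel_degrees" unfolding kernel_degrees_def by (intro CollectI bexI[OF _ one_mem]) simp
    show "a + b \<in> kernel_degrees" if ab: "a \<in> kernel_degrees" "b \<in> kernel_degrees" for a b
    proof -
      obtain x y where "x \<in> B a" "x \<noteq> 0" "D x = 0" "y \<in> B b" "y \<noteq> 0" "D y = 0"
        using ab by (auto simp: kernel_degrees_def)
      then show ?thesis unfolding kernel_degrees_def
        by (intro CollectI bexI[of _ "x * y"]) (auto simp: D_mult mult_mem)
    qed
    show "\<exists>n>0. nmult n a \<in> H" if "a \<in> kernel_degrees" for a
      using that torsion by (auto simp: kernel_degrees_def)
  qed (use H dmem in auto)
  then show thesis using that by (auto simp: kernel_degrees_def)
qed

text \<open>The multiple \<open>k D\<close> has degree \<open>d + j\<close> in \<open>H\<close> and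
  iterates \<open>k^n D^n\<close>, since \<open>k\<close> is in the kernel. It is nonzero on a power
  \<open>x^n\<close> in the subring whenever \<open>x\<close> is homogeneous with
  \<open>D x \<noteq> 0\<close>.\<close>

lemma ex_HLND_restriction: "\<exists>D'\<in>HLND B H. D' \<noteq> (\<lambda>_. 0)"
proof -
  let ?A = "subring_of_degrees B H"
  have sub: "is_subring ?A" by (rule is_subring_subring_of_degrees[OF H])
  obtain k j where k: "k \<in> B j" "k \<noteq> 0" "D k = 0" "d + j \<in> H" using ex_kernel_multiplier .
  define D' where "D' x = (if x \<in> ?A then k * D x else 0)" for x
  have D'_A: "D' x = k * D x" if "x \<in> ?A" for x using that by (simp add: D'_def)
  have hom: "k * D x \<in> B (i + (d + j))" if "x \<in> B i" for i x
    using mult_mem[OF k(1) degree[OF that]] by (simp add: ac_simps)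
  have A: "0 \<in> ?A" "x \<in> ?A \<Longrightarrow> y \<in> ?A \<Longrightarrow> x + y \<in> ?A" "x \<in> ?A \<Longrightarrow> y \<in> ?A \<Longrightarrow> x * y \<in> ?A" for x y
    using sub by (auto simp: is_subring_def is_subgroup_def)
  have mem: "D' x \<in> ?A" if "x \<in> ?A" for x
  proof -
    have "k * D x \<in> ?A" using that
    proof (induction rule: subring_of_degrees_induct)
      case (homogeneous x i)
      have "i + (d + j) \<in> H" by (rule is_subgroupD(2)[OF H \<open>i \<in> H\<close> k(4)])
      then show ?case using component_subset_subring_of_degrees hom[OF homogeneous(2)] by blast
    qed (auto simp: D_add distrib_left A)
    then show ?thesis using D'_A[OF that] by simp
  qed
  have "is_derivation ?A D'"
    unfolding is_derivation_def
    using mem by (auto simp: D'_A A D_add D_mult algebra_simps) (simp add: D'_def)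
  moreover have "locally_nilpotent ?A D'"
    unfolding locally_nilpotent_def
  proof
    fix x assume x: "x \<in> ?A"
    have "(D' ^^ n) x \<in> ?A \<and> (D' ^^ n) x = k ^ n * (D ^^ n) x" for n
    proof (induction n)
      case (Suc n)
      have "D (k ^ n) = 0" using D_power[of k n] k by simp
      moreover have y: "(D' ^^ n) x \<in> ?A" "(D' ^^ n) x = k ^ n * (D ^^ n) x" using Suc by auto
      ultimately have "D ((D' ^^ n) x) = k ^ n * (D ^^ Suc n) x" by (simp add: D_mult)
      then show ?case using mem[OF y(1)] D'_A[OF y(1)] by (simp add: mult.assoc)
    qed (use x in simp)
    then have "(D' ^^ Suc (deg x)) x = k ^ Suc (deg x) * (D ^^ Suc (deg x)) x" by blast
    then have "(D' ^^ Suc (deg x)) x = 0" unfolding deg_props(1)[OF UNIV_I] by simp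
    then show "\<exists>n>0. (D' ^^ n) x = 0" by blast
  qed
  moreover have "homogeneous B H D'"
    unfolding homogeneous_def
    using hom component_subset_subring_of_degrees[of _ H] D'_A
    by (intro bexI[OF _ k(4)] ballI) (auto simp: subset_iff)
  ultimately have "D' \<in> HLND B H" by (simp add: HLND_def)
  moreover have "D' \<noteq> (\<lambda>_. 0)"
  proof -
    obtain i x where x: "x \<in> B i" "D x \<noteq> 0" using ex_homogeneous_nonzero by blast
    then have x0: "x \<noteq> 0" by auto
    obtain n where n: "n > 0" "nmult n i \<in> H" using torsion[OF x(1) x0] by blast
    have "x ^ n \<in> ?A" using component_subset_subring_of_degrees[OF n(2)] power_mem[OF x(1)] by blast
    moreover have "D (x ^ n) * x \<noteq> 0"
      using D_power[of x n] char_0[OF n(1)] x(2) x0 by simp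
    ultimately have "D' (x ^ n) \<noteq> 0" using D'_A k(2) by simp
    then show ?thesis by auto
  qed
  ultimately show ?thesis by blast
qed

end

end

section \<open>Conclusion for algebras over a field of characteristic zero\<close>

lemma rational_ring_of_algebra:
  fixes \<iota> :: "'k::field_char_0 \<Rightarrow> 'b::comm_ring_1"
  assumes "algebra_map \<iota>"
  shows "rational_ring TYPE('b)"
  unfolding rational_ring_def
proof (intro allI impI)
  fix n :: nat assume "n > 0"
  have h: "\<iota> 1 = 1" "\<And>x y. \<iota> (x + y) = \<iota> x + \<iota> y" "\<And>x y. \<iota> (x * y) = \<iota> x * \<iota> y"
    using assms by (auto simp: algebra_map_def)
  have "\<iota> 0 = 0" using h(2)[of 0 0] by simp
  then have "\<iota> (of_nat n) = of_nat n" by (induction n) (simp_all add: h)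
  then have "of_nat n * \<iota> (1 / of_nat n) = 1" using h(3)[of "of_nat n" "1 / of_nat n"] h(1) \<open>n > 0\<close> by simp
  then show "\<exists>v::'b. of_nat n * v = 1" by blast
qed

theorem corollary6p2:
  fixes \<iota> :: "'k::field_char_0 \<Rightarrow> 'b::idom"
    and B :: "'g::ab_group_add \<Rightarrow> 'b set"
  assumes "fg_algebra \<iota>"
    and "normal_domain TYPE('b)"
    and "fg_group TYPE('g)"
    and "graded_over \<iota> B"
    and "saturated_codim1 B"
  shows "XX B = {} \<or> XX B = TT B"
proof (rule disjCI)
  assume "XX B \<noteq> TT B"
  show "XX B = {}"
  proof (rule ccontr)
    assume "XX B \<noteq> {}"
    then obtain H where HT: "H \<in> TT B" and HX: "HLND B H \<noteq> {\<lambda>_. 0}" by (auto simp: XX_def)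
    have alg: "algebra_map \<iota>" using assms(1) by (simp add: fg_algebra_def)
    have rational: "rational_ring TYPE('b)" by (rule rational_ring_of_algebra[OF alg])
    have one: "\<iota> 1 = 1" using alg by (simp add: algebra_map_def)
    interpret graded_ring B
      by unfold_locales (use assms(4) one in \<open>auto simp: graded_over_def intro!: subsetD[of "range \<iota>" _ 1] image_eqI[of 1 \<iota> 1]\<close>)
    have grpI: "i \<in> grp B" if "x \<in> B i" "x \<noteq> 0" for x i
      unfolding grp_def using that by (intro group_closure.base) auto
    have torsion: "\<exists>n>0. nmult n i \<in> H'" if "H' \<in> TT B" "x \<in> B i" "x \<noteq> 0" for H' x i
      using that(1) grpI[OF that(2,3)] by (auto simp: TT_def torsion_quotient_def nmult_def)
    have unit_degrees: "i \<in> group_closure (MM B P)" if "P \<in> Spec1" "x \<in> B i" "x \<noteq> 0" for P x i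
    proof -
      \<comment> \<open>\<open>P\<close> shows that \<open>Spec1\<close> is nonempty, so saturation
        identifies \<open>grp B\<close> with the intersection.\<close>
      have "i \<in> (\<Inter>P\<in>Spec1. MM_bar B P)"
        using assms(5) grpI[OF that(2,3)] that(1)
        unfolding saturated_codim1_def grp_bar_def by (metis empty_iff)
      then show ?thesis using that(1) by (auto simp: MM_bar_def)
    qed
    have H: "is_subgroup H" using HT by (simp add: TT_def)
    \<comment> \<open>As the zero derivation always belongs to \<open>HLND B H\<close>, differing
      from its singleton means having a nonzero member.\<close>
    have "(\<lambda>_. 0) \<in> HLND B H"
      unfolding HLND_def is_derivation_def locally_nilpotent_def homogeneous_def
      using is_subgroupD(1)[OF H] is_subring_subring_of_degrees[OF H] component_mem(1)
      by (auto simp: is_subring_def is_subgroup_def intro!: exI[of _ "Suc 0"])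
    then obtain D where D: "D \<in> HLND B H" "D \<noteq> (\<lambda>_. 0)" using HX by blast
    then obtain x where x: "D x \<noteq> 0" by auto
    obtain d where d: "d \<in> H" "\<And>i. i \<in> H \<Longrightarrow> D ` B i \<subseteq> B (i + d)"
      using D(1) by (auto simp: HLND_def homogeneous_def)
    interpret lnd: lnd_extension B H D d
      by unfold_locales
        (use D d H is_subring_subring_of_degrees[OF H] torsion[OF HT] unit_degrees rational
          fg_algebra_noetherian[OF assms(1)] assms(2) rational_ring_of_nat_neq_0[OF rational]
          in \<open>auto simp: HLND_def\<close>)
    interpret ext: graded_lnd B lnd.extension d
      by unfold_locales
        (use lnd.extension_derivation lnd.extension_locally_nilpotent lnd.extension_degree rational lnd.extension_nonzero[OF x]
          rational_ring_of_nat_neq_0[OF rational]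
          in \<open>auto simp: is_subring_def is_subgroup_def\<close>)
    \<comment> \<open>The extended derivation lives on the whole ring, so it can be restricted to an
      arbitrary \<open>H'\<close> in \<open>TT B\<close>.\<close>
    have "H' \<in> XX B" if "H' \<in> TT B" for H'
      using ext.ex_HLND_restriction[of H'] torsion[OF that] unit_degrees that
      by (fastforce simp: XX_def TT_def)
    then have "XX B = TT B" by (auto simp: XX_def)
    with \<open>XX B \<noteq> TT B\<close> show False by simp
  qed
qed

end
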